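(* Let $n\geq 10$ be even and let $P$ be a set of $n$ points in regular wheel configuration in the plane. Then the maximum number of pairwise edge-disjoint 1-plane Hamiltonian cycles that can be packed into the complete geometric graph $K_n$ on $P$ is $\lfloor (n-1)/3\rfloor$; that is, every family of pairwise edge-disjoint 1-plane Hamiltonian cycles on $P$ has at most $\lfloor (n-1)/3\rfloor$ members, and there exists a family of $\lfloor (n-1)/3\rfloor$ pairwise edge-disjoint 1-plane Hamiltonian cycles on $P$.
   Context: A geometric graph on a finite planar point set $P$ has vertex set $P$ and its edges are straight-line segments with endpoints in $P$; the complete geometric graph $K_n$ on $P$ ($|P|=n$) contains all segments joining pairs of points of $P$. A set $P$ of $n$ points is in regular wheel configuration if $n-1$ of its points are regularly spaced on a circle (the vertices of a regular $(n-1)$-gon) and the remaining point is the center of that circle. Two edges cross if they share a point that is interior to both segments. A geometric graph is 1-plane if each of its edges is crossed by at most one other edge of that graph. A 1-plane Hamiltonian cycle (1-PHC) on $P$ is a Hamiltonian cycle of $K_n$ that is 1-plane as a geometric graph. Subgraphs are edge-disjoint if they share no edge, and a packing is a set of pairwise edge-disjoint subgraphs (edges of different cycles may cross arbitrarily). *)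

theory Defs
  imports "HOL-Analysis.Analysis" "HOL-Library.Ramsey"
begin

text \<open>
  The plane is modelled by \<^typ>\<open>complex\<close>. An edge is the two-element set of its endpoints, and a
  geometric graph on a point set is given by its set of edges.
\<close>

text \<open>The points are determined by the centre \<open>c\<close>, the radius \<open>r\<close> and the angle \<open>t\<close> of one rim point.\<close>

definition regular_wheel :: "nat \<Rightarrow> complex set \<Rightarrow> bool" where
  "regular_wheel n P \<longleftrightarrow> card P = n \<and>
     (\<exists>c r t. r > 0 \<and>
        P = insert c ((\<lambda>k. c + of_real r * cis (t + 2 * pi * real k / real (n - 1))) ` {..<n - 1}))"

abbreviation complete_graph :: "'a set \<Rightarrow> 'a set set" where
  "complete_graph P \<equiv> nsets P 2"

definition crosses :: "complex set \<Rightarrow> complex set \<Rightarrow> bool" where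
  "crosses e f \<longleftrightarrow>
     (\<exists>a b c d. e = {a, b} \<and> f = {c, d} \<and> open_segment a b \<inter> open_segment c d \<noteq> {})"

definition one_plane :: "complex set set \<Rightarrow> bool" where
  "one_plane E \<longleftrightarrow> (\<forall>e\<in>E. \<exists>\<^sub>\<le>\<^sub>1 f. f \<in> E \<and> f \<noteq> e \<and> crosses e f)"

text \<open>
  A Hamiltonian cycle is identified with its edge set; the list \<open>xs\<close> is a cyclic enumeration of all
  vertices.
\<close>

definition hamiltonian_cycle :: "'a set \<Rightarrow> 'a set set \<Rightarrow> 'a set set \<Rightarrow> bool" where
  "hamiltonian_cycle V E C \<longleftrightarrow> C \<subseteq> E \<and>
     (\<exists>xs. distinct xs \<and> set xs = V \<and> length xs \<ge> 3 \<and>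
        C = (\<lambda>i. {xs ! i, xs ! (Suc i mod length xs)}) ` {..<length xs})"

definition one_phc :: "complex set \<Rightarrow> complex set set \<Rightarrow> bool" where
  "one_phc P C \<longleftrightarrow> hamiltonian_cycle P (complete_graph P) C \<and> one_plane C"

definition one_phc_packing :: "complex set \<Rightarrow> complex set set set \<Rightarrow> bool" where
  "one_phc_packing P F \<longleftrightarrow> (\<forall>C\<in>F. one_phc P C) \<and> disjoint F"

end

theory Submission
  imports Defs
begin

text \<open>
  Put \<open>m = n - 1\<close>, an odd number that is at least 9. The rim points are the corners of a regular
  \<open>m\<close>-gon, and since \<open>m\<close> is odd no chord passes through the centre, so every chord has a short side
  away from the centre.

  Upper bound. The idea is to charge cycles for what they do near the boundary of the polygon.
  A cycle \<open>C\<close> gets one token for each side of the polygon that it contains, and one token for each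
  corner \<open>v\<close> that is an \<^emph>\<open>apex\<close> of \<open>C\<close>: of the three edges in the triangle formed by \<open>v\<close> and its two
  neighbours, \<open>C\<close> contains at least two. Two pairs out of three edges have an edge in common, so
  edge-disjoint cycles have disjoint token sets. There are only \<open>2 * m\<close> possible tokens, and
  \<open>six_tokens\<close> says that every 1-plane Hamiltonian cycle has at least six. Hence a packing of \<open>k\<close>
  cycles satisfies \<open>6 * k \<le> 2 * m\<close>.

  That there are six tokens comes from parity: a Hamiltonian cycle meets every cut in a positive
  even number of edges. If a chord \<open>e\<close> of the cycle cuts off a nonempty arc, then besides the edge at
  each end of \<open>e\<close> at most one edge can leave that arc, because it crosses \<open>e\<close>. Counting such
  cuts shows that exactly one edge crosses \<open>e\<close> and that its end inside the arc is a neighbour of an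
  end of \<open>e\<close>. The crossing edge is either a spoke or the translate of \<open>e\<close> by one step
  (\<open>chord_shape\<close>). In the second case, called a \<open>block\<close>, the cycle traverses an arc of the rim from
  one end to the other before leaving it, and an innermost such arc has three tokens. The
  complement of a longest block has three more: a block inside it would give them, and otherwise
  every chord there is crossed by a spoke, so that there are at most two of them and the other
  edges are sides.

  Lower bound. Number the corners by integers modulo \<open>m\<close>. For every \<open>q\<close> the chords
  \<open>{q - y, q + y}\<close>, the chords \<open>{q + 1 - u, q + 1 + u}\<close> and the side \<open>{q, q + 1}\<close> form a zigzag
  Hamiltonian cycle of the rim, in which the two chords with \<open>y = u < (m - 1) / 2\<close> cross and
  there are no other crossings. One chord next to the centre is then replaced by the spokes to its two ends; this
  creates a crossing only with the former partner of that chord. The index sums of the rim edges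
  are \<open>2 * q\<close>, \<open>2 * q + 2\<close> and \<open>2 * q + 1\<close> modulo \<open>m\<close>, so taking \<open>2 * q\<close> congruent to
  \<open>0, 3, 6, \<dots>\<close> gives \<open>m div 3\<close> edge-disjoint cycles.
\<close>

section \<open>Crossings between the points of a wheel\<close>

text \<open>Twice the signed area of the triangle \<open>A B X\<close>. Crossings are decided by its sign, which for rim
  points depends only on their cyclic order.\<close>

definition orient :: "complex \<Rightarrow> complex \<Rightarrow> complex \<Rightarrow> real" where
  "orient A B X = Im (cnj (B - A) * (X - A))"

lemma orient_same [simp]: "orient A B A = 0" "orient A B B = 0"
  by (simp_all add: orient_def algebra_simps)

lemma orient_rotate: "orient A B X = orient B X A"
  by (simp add: orient_def algebra_simps)

lemma orient_swap: "orient B A X = - orient A B X"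
  by (simp add: orient_def algebra_simps)

lemma orient_combination:
  "orient A B ((1 - u) *\<^sub>R X + u *\<^sub>R Y) = (1 - u) * orient A B X + u * orient A B Y"
  by (simp add: orient_def algebra_simps)

lemma crosses_iff_segments:
  "crosses {A, B} {X, Y} \<longleftrightarrow> open_segment A B \<inter> open_segment X Y \<noteq> {}"
  unfolding crosses_def by (metis doubleton_eq_iff open_segment_commute)

lemma crosses_sym: "crosses e f \<Longrightarrow> crosses f e"
  unfolding crosses_def by (metis inf_commute)

lemma crosses_if_orient:
  assumes "orient A B X * orient A B Y < 0" "orient X Y A * orient X Y B < 0"
  shows "crosses {A, B} {X, Y}"
proof -
  define d where "d = orient A B X - orient A B Y"
  define u where "u = orient A B X / d"
  define s where "s = - orient X Y A / d"
  have d': "d = orient X Y B - orient X Y A"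
    by (simp add: d_def orient_def algebra_simps)
  have d0: "d \<noteq> 0" using assms(1) by (auto simp: d_def mult_less_0_iff)
  have u: "0 < u" "u < 1"
    using assms(1) by (auto simp: u_def d_def mult_less_0_iff divide_simps)
  have s: "0 < s" "s < 1"
    using assms(2) by (auto simp: s_def d' mult_less_0_iff divide_simps)
  have XY: "X \<noteq> Y" and AB: "A \<noteq> B" using assms by auto
  \<comment> \<open>Both sides are the intersection of the lines \<open>X Y\<close> and \<open>A B\<close>, scaled by the common denominator \<open>d\<close>.\<close>
  have "d *\<^sub>R ((1 - u) *\<^sub>R X + u *\<^sub>R Y) = (d - orient A B X) *\<^sub>R X + orient A B X *\<^sub>R Y"
    using d0 by (simp add: u_def algebra_simps)
  also have "\<dots> = (d + orient X Y A) *\<^sub>R A - orient X Y A *\<^sub>R B"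
    by (simp add: complex_eq_iff d_def orient_def algebra_simps)
  also have "\<dots> = d *\<^sub>R ((1 - s) *\<^sub>R A + s *\<^sub>R B)"
    using d0 by (simp add: s_def algebra_simps)
  finally have "(1 - u) *\<^sub>R X + u *\<^sub>R Y = (1 - s) *\<^sub>R A + s *\<^sub>R B"
    using d0 by simp
  moreover have "(1 - u) *\<^sub>R X + u *\<^sub>R Y \<in> open_segment X Y"
    using u XY unfolding in_segment by blast
  moreover have "(1 - s) *\<^sub>R A + s *\<^sub>R B \<in> open_segment A B"
    using s AB unfolding in_segment by blast
  ultimately show ?thesis
    unfolding crosses_iff_segments by auto
qed

text \<open>The orientation with respect to \<open>A B\<close> is affine along \<open>X Y\<close> and vanishes at the crossing point,
  which lies strictly between \<open>X\<close> and \<open>Y\<close>. The degenerate alternative is that all four points are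
  collinear.\<close>

lemma orient_if_crosses:
  assumes "crosses {A, B} {X, Y}"
  shows "orient A B X * orient A B Y < 0 \<or> (orient A B X = 0 \<and> orient A B Y = 0)"
proof -
  obtain u s where "0 < u" "u < 1"
    and eq: "(1 - u) *\<^sub>R X + u *\<^sub>R Y = (1 - s) *\<^sub>R A + s *\<^sub>R B"
    using assms unfolding crosses_iff_segments by (auto simp: in_segment) metis
  have "(1 - u) * orient A B X + u * orient A B Y = 0"
    by (simp add: eq flip: orient_combination) (simp add: orient_combination)
  then show ?thesis
    using \<open>0 < u\<close> \<open>u < 1\<close>
    by (smt (verit) mult_neg_pos mult_pos_neg mult_pos_pos mult_minus_right zero_less_mult_iff)
qed

text \<open>The number \<open>m\<close> of rim points is odd, and \<open>h\<close> is the largest number of steps that a chord spans on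
  its short side. Indices of rim points are arbitrary integers, so that an arc through the last point
  is an interval of integers like any other.\<close>

locale wheel_points =
  fixes c :: complex and r \<theta> :: real and m h :: int
  assumes r_pos: "r > 0" and m_eq: "m = 2 * h + 1" and h_ge: "h \<ge> 4"
begin

definition p :: "int \<Rightarrow> complex" where
  "p i = c + of_real r * cis (\<theta> + 2 * pi * of_int i / of_int m)"

lemma m_pos: "m > 0" using m_eq h_ge by simp

lemma sin_step_pos: "0 < d \<Longrightarrow> d < m \<Longrightarrow> sin (pi * of_int d / of_int m) > 0"
  by (rule sin_gt_zero) (auto simp: divide_simps)

text \<open>The inscribed angle theorem turns the area of a triangle on a circle into a product of sines of
  half the central angles.\<close>

lemma orient_rim:
  "orient (p i) (p j) (p k) = 4 * r\<^sup>2 * sin (pi * of_int (j - i) / of_int m)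
     * sin (pi * of_int (k - j) / of_int m) * sin (pi * of_int (k - i) / of_int m)"
proof -
  define x y a where "x = pi * of_int (j - i) / of_int m" and "y = pi * of_int (k - j) / of_int m"
    and "a = \<theta> + 2 * pi * of_int i / of_int m"
  have m0: "real_of_int m \<noteq> 0" using m_pos by simp
  have pi: "p i = c + of_real r * cis a" by (simp add: p_def a_def)
  have pj: "p j = c + of_real r * cis (a + 2 * x)"
    using m0 by (simp add: p_def a_def x_def add_divide_distrib diff_divide_distrib algebra_simps)
  have pk: "p k = c + of_real r * cis (a + 2 * x + 2 * y)"
    using m0 by (simp add: p_def a_def x_def y_def add_divide_distrib diff_divide_distrib algebra_simps)
  have xy: "pi * of_int (k - i) / of_int m = x + y"
    using m0 by (simp add: x_def y_def field_simps)
  have s1: "4 * sin x * sin y * sin (x + y) = sin (2 * x) + sin (2 * y) - sin (2 * x + 2 * y)"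
  proof -
    have "sin (2 * x) + sin (2 * y) - sin (2 * x + 2 * y)
       = sin (2 * x) * (1 - cos (2 * y)) + sin (2 * y) * (1 - cos (2 * x))"
      by (simp add: sin_add algebra_simps)
    also have "\<dots> = 2 * sin x * cos x * (1 - cos (2 * y)) + 2 * sin y * cos y * (1 - cos (2 * x))"
      by (simp only: sin_double)
    also have "\<dots> = 2 * sin x * cos x * (2 * (sin y)\<^sup>2) + 2 * sin y * cos y * (2 * (sin x)\<^sup>2)"
      by (simp add: cos_double_sin)
    finally show ?thesis by (simp add: sin_add power2_eq_square algebra_simps)
  qed
  have s2: "Im (cnj (cis (a + u) - cis a) * (cis (a + u + v) - cis a))
      = sin u + sin v - sin (u + v)" for u v
  proof -
    have "cnj (cis (a + u) - cis a) * (cis (a + u + v) - cis a)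
       = cis v - cis (- u) - cis (u + v) + 1"
      by (simp add: algebra_simps cis_cnj cis_mult)
    then show ?thesis by simp
  qed
  have "orient (p i) (p j) (p k) = r\<^sup>2 * Im (cnj (cis (a + 2 * x) - cis a) * (cis (a + 2 * x + 2 * y) - cis a))"
    by (simp add: orient_def pi pj pk algebra_simps power2_eq_square)
  also have "\<dots> = r\<^sup>2 * (4 * sin x * sin y * sin (x + y))"
    by (simp only: s2 s1)
  finally show ?thesis by (simp only: xy x_def y_def mult.assoc mult.left_commute)
qed

lemma orient_rim_pos: "i < j \<Longrightarrow> j < k \<Longrightarrow> k < i + m \<Longrightarrow> orient (p i) (p j) (p k) > 0"
  using sin_step_pos[of "j - i"] sin_step_pos[of "k - j"] sin_step_pos[of "k - i"] r_pos
  unfolding orient_rim by simp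

lemma orient_centre: "orient c (p i) (p j) = r\<^sup>2 * sin (2 * pi * of_int (j - i) / of_int m)"
proof -
  have m0: "real_of_int m \<noteq> 0" using m_pos by simp
  have e: "\<theta> + 2 * pi * of_int j / of_int m =
      (\<theta> + 2 * pi * of_int i / of_int m) + 2 * pi * of_int (j - i) / of_int m"
    using m0 by (simp add: field_simps)
  have *: "cnj (of_real r * cis a) * (of_real r * cis (a + b)) = of_real (r\<^sup>2) * cis b" for a b
    by (simp add: cis_cnj cis_mult power2_eq_square)
  have "cnj (p i - c) * (p j - c) = of_real (r\<^sup>2) * cis (2 * pi * of_int (j - i) / of_int m)"
    unfolding p_def e add_diff_cancel_left' by (rule *)
  then show ?thesis unfolding orient_def by simp
qed

lemma orient_centre_pos: "i < j \<Longrightarrow> j - i \<le> h \<Longrightarrow> orient c (p i) (p j) > 0"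
proof -
  assume a: "i < j" "j - i \<le> h"
  have "sin (2 * pi * of_int (j - i) / of_int m) = sin (pi * of_int (2 * (j - i)) / of_int m)"
    by (simp add: algebra_simps)
  also have "\<dots> > 0" by (rule sin_step_pos) (use a m_eq in auto)
  finally show ?thesis using r_pos unfolding orient_centre by simp
qed

lemma p_periodic: "p (i + m) = p i"
proof -
  have m0: "real_of_int m \<noteq> 0" using m_pos by simp
  have e: "\<theta> + 2 * pi * of_int (i + m) / of_int m = (\<theta> + 2 * pi * of_int i / of_int m) + 2 * pi"
    using m0 by (simp add: field_simps)
  show ?thesis unfolding p_def e by (simp add: cis_mult[symmetric])
qed

lemma p_neq_centre: "p i \<noteq> c"
  using r_pos by (simp add: p_def)

lemma p_neq: assumes "i < j" "j < i + m" shows "p i \<noteq> p j"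
proof (cases "j = i + m - 1")
  case False
  then have "orient (p i) (p j) (p (i + m - 1)) > 0" using assms by (intro orient_rim_pos) auto
  then show ?thesis by (auto simp: orient_def)
next
  case True
  then have "orient (p i) (p (i + 1)) (p j) > 0" using assms m_eq h_ge by (intro orient_rim_pos) auto
  then show ?thesis by (metis less_irrefl orient_same(1))
qed

lemma p_mod: "p (i mod m) = p i"
proof -
  have "p (x + of_nat k * m) = p x" for x k
  proof (induction k)
    case (Suc k)
    have "x + of_nat (Suc k) * m = (x + of_nat k * m) + m" by (simp add: algebra_simps)
    then show ?case using Suc p_periodic by metis
  qed simp
  note * = this
  have **: "p (x + k * m) = p x" for x k
  proof (cases "k \<ge> 0")
    case True then show ?thesis using *[of x "nat k"] by simp
  next
    case False then show ?thesis using *[of "x + k * m" "nat (- k)"] by simp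
  qed
  show ?thesis using **[of "i mod m" "i div m"] by (simp add: algebra_simps)
qed

lemma p_eq_iff: "p i = p j \<longleftrightarrow> m dvd i - j"
proof -
  have "p (i mod m) = p (j mod m) \<longleftrightarrow> i mod m = j mod m"
    using p_neq[of "i mod m" "j mod m"] p_neq[of "j mod m" "i mod m"] m_pos
    by (smt (verit, del_insts) pos_mod_bound pos_mod_sign)
  then show ?thesis by (simp add: p_mod mod_eq_dvd_iff)
qed

text \<open>Chords cross as soon as their ends alternate around the rim.\<close>

lemma chords_cross: 
  assumes "a < x" "x < b" "b < y" "y < a + m" shows "crosses {p a, p b} {p x, p y}"
proof (rule crosses_if_orient)
  have "orient (p a) (p b) (p x) < 0"
    using orient_rim_pos[of a x b] assms orient_rotate orient_swap by (smt (verit))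
  moreover have "orient (p a) (p b) (p y) > 0" using orient_rim_pos assms by simp
  ultimately show "orient (p a) (p b) (p x) * orient (p a) (p b) (p y) < 0"
    by (simp add: mult_neg_pos)
  have "orient (p x) (p y) (p b) < 0"
    using orient_rim_pos[of x b y] assms orient_rotate orient_swap by (smt (verit))
  moreover have "orient (p x) (p y) (p a) > 0"
    using orient_rim_pos[of x y "a + m"] assms by (simp add: p_periodic)
  ultimately show "orient (p x) (p y) (p a) * orient (p x) (p y) (p b) < 0"
    by (simp add: mult_pos_neg)
qed

text \<open>A chord that spans at most \<open>h\<close> steps separates the open arc below it from the centre.\<close>

lemma spoke_crosses_chord:
  assumes "a < x" "x < b" "b - a \<le> h" shows "crosses {p a, p b} {c, p x}"
proof (rule crosses_if_orient)
  have "orient (p a) (p b) (p x) < 0"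
    using orient_rim_pos[of a x b] assms m_eq h_ge orient_rotate orient_swap by (smt (verit))
  moreover have "orient (p a) (p b) c > 0" using orient_centre_pos[of a b] orient_rotate assms by (smt (verit))
  ultimately show "orient (p a) (p b) c * orient (p a) (p b) (p x) < 0"
    by (simp add: mult_pos_neg)
  have "orient c (p x) (p b) > 0" using orient_centre_pos assms by simp
  moreover have "orient c (p x) (p a) < 0"
    using orient_centre_pos[of a x] assms orient_rotate orient_swap by (smt (verit))
  ultimately show "orient c (p x) (p a) * orient c (p x) (p b) < 0"
    by (simp add: mult_neg_pos)
qed

text \<open>The indices \<open>k\<close> and \<open>l\<close> are taken in the period that starts at \<open>a\<close>; every rim point has such an
  index by \<open>lift_index\<close>.\<close>

lemma chords_cross_imp:
  assumes "crosses {p a, p b} {p k, p l}" "{p k, p l} \<noteq> {p a, p b}" "k \<noteq> l"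
    and "a < b" "b < a + m" "a \<le> k" "k < a + m" "a \<le> l" "l < a + m"
  shows "(a < k \<and> k < b \<and> b < l) \<or> (a < l \<and> l < b \<and> b < k)"
proof -
  have pos: "orient (p a) (p b) (p x) > 0" if "b < x" "x < a + m" for x
    using orient_rim_pos assms that by simp
  have neg: "orient (p a) (p b) (p x) < 0" if "a < x" "x < b" for x
    using orient_rim_pos[of a x b] assms that orient_rotate orient_swap by (smt (verit))
  have side: "(k = a \<or> k = b) \<or> (a < k \<and> k < b) \<or> (b < k)" "(l = a \<or> l = b) \<or> (a < l \<and> l < b) \<or> (b < l)"
    using assms by auto
  have zero: "\<not> ((k = a \<or> k = b) \<and> (l = a \<or> l = b))"
    using assms(2,3) by auto
  have *: "orient (p a) (p b) (p k) * orient (p a) (p b) (p l) < 0 \<or>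
      (orient (p a) (p b) (p k) = 0 \<and> orient (p a) (p b) (p l) = 0)"
    by (rule orient_if_crosses[OF assms(1)])
  from side show ?thesis
    using * zero pos[of k] pos[of l] neg[of k] neg[of l] assms(7,9)
    by (auto simp: mult_less_0_iff)
qed

lemma spoke_crosses_imp:
  assumes "crosses {p a, p b} {c, p k}" "a < b" "b - a \<le> h" "a \<le> k" "k < a + m"
  shows "a < k \<and> k < b"
proof -
  have "orient (p a) (p b) c > 0" using orient_centre_pos[of a b] orient_rotate assms by (smt (verit))
  then have neg: "orient (p a) (p b) (p k) < 0"
    using orient_if_crosses[OF assms(1)] by (auto simp: mult_less_0_iff)
  then have "k \<noteq> a" "k \<noteq> b" by auto
  moreover have "\<not> b < k"
    using neg orient_rim_pos[of a b k] assms by auto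
  ultimately show ?thesis using assms by auto
qed

lemma spokes_do_not_cross:
  assumes "i < j" "j - i \<le> h" shows "\<not> crosses {c, p i} {c, p j}"
  using orient_if_crosses[of c "p i" c "p j"] orient_centre_pos[OF assms] by auto

definition points :: "complex set" where "points = insert c (range p)"

lemma p_inj: "p i = p j \<Longrightarrow> i - j < m \<Longrightarrow> j - i < m \<Longrightarrow> i = j"
  using dvd_imp_le_int[of "i - j" m] m_pos by (cases "i = j") (auto simp: p_eq_iff)

lemma p_shift: "p (i + m) = p i" "p (i - m) = p i"
  by (simp_all add: p_eq_iff)

lemma lift_index: obtains k' where "p k' = p k" "a \<le> k'" "k' < a + m"
proof -
  have "p (a + (k - a) mod m) = p k"
    using dvd_minus_mod[of m "k - a"] by (simp add: p_eq_iff algebra_simps dvd_diff_commute)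
  then show ?thesis using that[of "a + (k - a) mod m"] m_pos by simp
qed

lemma range_p: "range p = p ` {0..<m}"
proof -
  have "p i \<in> p ` {0..<m}" for i using p_mod[of i] m_pos by (metis atLeastLessThan_iff imageI pos_mod_bound pos_mod_sign)
  then show ?thesis by auto
qed

lemma card_points: "finite points" "card points = Suc (nat m)"
proof -
  have "inj_on p {0..<m}" by (rule inj_onI) (auto dest!: p_inj)
  moreover have "c \<notin> p ` {0..<m}" using p_neq_centre by (metis imageE)
  ultimately show "finite points" "card points = Suc (nat m)"
    unfolding points_def range_p by (simp_all add: card_image)
qed

end

section \<open>Cuts of Hamiltonian cycles\<close>

definition cut :: "'a set set \<Rightarrow> 'a set \<Rightarrow> 'a set set" where
  "cut C X = {e \<in> C. e \<inter> X \<noteq> {} \<and> \<not> e \<subseteq> X}"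

lemma cut_Un: "cut C (X \<union> Y) \<subseteq> cut C X \<union> cut C Y"
  by (auto simp: cut_def)

text \<open>Summing the degrees over \<open>X\<close> counts the edges inside \<open>X\<close> twice and the edges of the cut once. In
  particular every cut of a Hamiltonian cycle has an even number of edges.\<close>

lemma handshake_cut:
  assumes "finite C" "C \<subseteq> nsets V 2" "finite X" and deg: "\<And>v. v \<in> X \<Longrightarrow> card {e \<in> C. v \<in> e} = 2"
  shows "2 * card X = 2 * card {e \<in> C. e \<subseteq> X} + card (cut C X)"
proof -
  have two: "finite e \<and> card e = 2" if "e \<in> C" for e using assms(2) that by (auto simp: nsets_def)
  have inter: "card (e \<inter> X) = (if e \<subseteq> X then 2 else 0) + (if e \<in> cut C X then 1 else 0)" if e: "e \<in> C" for e
  proof (cases "e \<subseteq> X")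
    case True
    then have "e \<inter> X = e" by auto
    with True two[OF e] show ?thesis by (simp add: cut_def)
  next
    case False
    then have "card (e \<inter> X) < card e" using two[OF e] by (intro psubset_card_mono) auto
    then have "card (e \<inter> X) \<le> 1" using two[OF e] by simp
    moreover have "card (e \<inter> X) = 0 \<longleftrightarrow> e \<inter> X = {}" using two[OF e] by simp
    ultimately show ?thesis using False e by (auto simp: cut_def)
  qed
  have "2 * card X = (\<Sum>v\<in>X. card {e \<in> C. v \<in> e})" using deg by simp
  also have "\<dots> = (\<Sum>v\<in>X. \<Sum>e\<in>C. if v \<in> e then 1 else 0)"
    using assms(1) by (intro sum.cong refl) (simp add: sum.If_cases Int_def)
  also have "\<dots> = (\<Sum>e\<in>C. \<Sum>v\<in>X. if v \<in> e then 1 else 0)" by (rule sum.swap)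
  also have "\<dots> = (\<Sum>e\<in>C. card (e \<inter> X))"
    using assms(3) by (intro sum.cong refl) (simp add: sum.If_cases Int_def conj_commute)
  also have "\<dots> = (\<Sum>e\<in>C. (if e \<subseteq> X then 2 else 0) + (if e \<in> cut C X then 1 else 0))"
    by (intro sum.cong refl inter)
  also have "\<dots> = 2 * card {e \<in> C. e \<subseteq> X} + card (cut C X)"
    using assms(1) by (simp add: sum.distrib sum.If_cases Int_def cut_def)
  finally show ?thesis .
qed

lemma hamiltonian_cycle_regular_connected:
  assumes "hamiltonian_cycle V E C"
  shows hamiltonian_cycle_degree: "v \<in> V \<Longrightarrow> card {e \<in> C. v \<in> e} = 2"
    and hamiltonian_cycle_cut: "X \<subseteq> V \<Longrightarrow> X \<noteq> {} \<Longrightarrow> X \<noteq> V \<Longrightarrow> cut C X \<noteq> {}"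
    and hamiltonian_cycle_finite: "finite C"
proof -
  obtain xs where xs: "distinct xs" "set xs = V" "length xs \<ge> 3"
    and C: "C = (\<lambda>i. {xs ! i, xs ! (Suc i mod length xs)}) ` {..<length xs}"
    using assms unfolding hamiltonian_cycle_def by auto
  define N where "N = length xs"
  define s where "s i = (if Suc i = N then 0 else Suc i)" for i
  have C': "C = (\<lambda>i. {xs ! i, xs ! s i}) ` {..<N}"
    unfolding C N_def s_def by (intro image_cong) (auto simp: mod_Suc)
  have N: "N \<ge> 3" using xs N_def by simp
  have eq: "xs ! i = xs ! j \<longleftrightarrow> i = j" if "i < N" "j < N" for i j
    using that xs N_def by (simp add: nth_eq_iff_index_eq)
  have s_lt: "s i < N" if "i < N" for i using that by (auto simp: s_def)
  show "finite C" unfolding C by simp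
  show "card {e \<in> C. v \<in> e} = 2" if v: "v \<in> V" for v
  proof -
    obtain i where i: "i < N" "v = xs ! i" using v xs N_def by (metis in_set_conv_nth)
    define q where "q = (if i = 0 then N - 1 else i - 1)"
    have q: "q < N" using i N by (auto simp: q_def)
    have sj: "s j = i \<longleftrightarrow> j = q" if "j < N" for j using that i N by (auto simp: s_def q_def)
    have "v \<in> {xs ! j, xs ! s j} \<longleftrightarrow> j = i \<or> j = q" if "j < N" for j
      using eq[of i j] eq[of i "s j"] sj[OF that] s_lt[OF that] i that by auto
    then have "{e \<in> C. v \<in> e} = (\<lambda>j. {xs ! j, xs ! s j}) ` {i, q}"
      using i(1) q unfolding C' by blast
    moreover have "{xs ! i, xs ! s i} \<noteq> {xs ! q, xs ! s q}"
    proof -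
      have "s q = i" "s i \<noteq> q" "q \<noteq> i" using sj q i N by (auto simp: s_def q_def split: if_splits)
      then show ?thesis using eq i(1) q s_lt by (metis doubleton_eq_iff)
    qed
    ultimately show ?thesis by simp
  qed
  show "cut C X \<noteq> {}" if X: "X \<subseteq> V" "X \<noteq> {}" "X \<noteq> V"
  proof
    assume none: "cut C X = {}"
    have step: "xs ! s i \<in> X" if "i < N" "xs ! i \<in> X" for i
    proof (rule ccontr)
      assume "xs ! s i \<notin> X"
      then have "{xs ! i, xs ! s i} \<in> cut C X" using that by (auto simp: cut_def C')
      then show False using none by simp
    qed
    obtain i where i: "i < N" "xs ! i \<in> X" using X xs N_def by (metis all_not_in_conv in_set_conv_nth subsetD)
    have up: "j < N \<Longrightarrow> xs ! j \<in> X" if "j \<ge> k" "xs ! k \<in> X" "k < N" for j k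
      using that(1)
    proof (induction j rule: dec_induct)
      case base then show ?case using that by simp
    next
      case (step j)
      then have "xs ! s j \<in> X" using \<open>\<And>i. i < N \<Longrightarrow> xs ! i \<in> X \<Longrightarrow> xs ! s i \<in> X\<close> by simp
      then show ?case using step by (simp add: s_def)
    qed
    have "xs ! (N - 1) \<in> X" using up[of i "N - 1"] i by simp
    then have "xs ! 0 \<in> X" using step[of "N - 1"] N by (simp add: s_def)
    then have "xs ! j \<in> X" if "j < N" for j using up[of 0 j] that by simp
    then have "V \<subseteq> X" using xs(2) N_def by (metis in_set_conv_nth subsetI)
    then show False using X by auto
  qed
qed

section \<open>How a chord of a 1-plane cycle is crossed\<close>

text \<open>The combinatorial content of a 1-plane Hamiltonian cycle on a wheel. Apart from the cycle being
  connected and 2-regular, this is the existence of crossings between alternating chords and between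
  spokes and short chords. The crossing relation is a parameter and nothing refers to the plane,
  so that reversing the orientation of the rim is again an instance (\<open>reflected\<close>); this halves the case
  distinctions.\<close>

locale one_plane_wheel_cycle =
  fixes p :: "int \<Rightarrow> 'a" and c :: 'a and m h :: int and C :: "'a set set"
    and crs :: "'a set \<Rightarrow> 'a set \<Rightarrow> bool"
  assumes m_eq: "m = 2 * h + 1" and h_ge: "h \<ge> 4"
    and p_eq_iff: "p i = p j \<longleftrightarrow> m dvd i - j"
    and p_neq_c: "p i \<noteq> c"
    and finite_C: "finite C"
    and C_edges: "C \<subseteq> nsets (insert c (range p)) 2"
    and degree_two: "v \<in> insert c (range p) \<Longrightarrow> card {e \<in> C. v \<in> e} = 2"
    and connected_cut: "X \<subseteq> insert c (range p) \<Longrightarrow> X \<noteq> {} \<Longrightarrow> X \<noteq> insert c (range p) \<Longrightarrow> cut C X \<noteq> {}"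
    and crs_sym: "crs e f \<Longrightarrow> crs f e"
    and crossed_once: "e \<in> C \<Longrightarrow> f \<in> C \<Longrightarrow> g \<in> C \<Longrightarrow> f \<noteq> e \<Longrightarrow> g \<noteq> e \<Longrightarrow> crs e f \<Longrightarrow> crs e g \<Longrightarrow> f = g"
    and chords_cross: "a < x \<Longrightarrow> x < b \<Longrightarrow> b < y \<Longrightarrow> y < a + m \<Longrightarrow> crs {p a, p b} {p x, p y}"
    and spoke_crosses: "a < x \<Longrightarrow> x < b \<Longrightarrow> b - a \<le> h \<Longrightarrow> crs {p a, p b} {c, p x}"
begin

lemma m_pos: "m > 0" using m_eq h_ge by simp

lemma p_shift: "p (i + m) = p i" "p (i - m) = p i"
  by (simp_all add: p_eq_iff)

lemma p_inj: "p i = p j \<Longrightarrow> i - j < m \<Longrightarrow> j - i < m \<Longrightarrow> i = j"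
  using dvd_imp_le_int[of "i - j" m] m_pos by (cases "i = j") (auto simp: p_eq_iff)

lemma p_eq_near: "i - j < m \<Longrightarrow> j - i < m \<Longrightarrow> p i = p j \<longleftrightarrow> i = j"
  using p_inj by auto

lemma vertex_cases:
  assumes "v \<in> insert c (range p)"
  obtains "v = c" | j where "a \<le> j" "j < a + m" "v = p j"
proof (cases "v = c")
  case False
  then obtain k where k: "v = p k" using assms by auto
  define j where "j = a + (k - a) mod m"
  have "v = p j" unfolding k p_eq_iff j_def
    using dvd_minus_mod[of m "k - a"] by (simp add: algebra_simps)
  moreover have "a \<le> j" "j < a + m" using m_pos by (auto simp: j_def)
  ultimately show ?thesis using that by blast
qed (use that in blast)

lemma edge_at:
  assumes "g \<in> C" "v \<in> g" obtains w where "g = {v, w}" "w \<noteq> v" "w \<in> insert c (range p)"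
proof -
  obtain x y where xy: "g = {x, y}" "x \<in> insert c (range p)" "y \<in> insert c (range p)" "x \<noteq> y"
    using assms C_edges by (meson nsets2_E subsetD)
  show ?thesis
  proof (cases "v = x")
    case True then show ?thesis using that[of y] xy by auto
  next
    case False then have "v = y" using xy assms by auto
    then show ?thesis using that[of x] xy by auto
  qed
qed

lemma other_edge:
  assumes "e \<in> C" "v \<in> e"
  obtains g where "g \<in> C" "g \<noteq> e" "v \<in> g" "\<And>k. k \<in> C \<Longrightarrow> v \<in> k \<Longrightarrow> k = e \<or> k = g"
proof -
  have "v \<in> insert c (range p)" using assms C_edges by (auto simp: nsets_def)
  then have "card {e \<in> C. v \<in> e} = 2" by (rule degree_two)
  then obtain x y where "{e \<in> C. v \<in> e} = {x, y}" "x \<noteq> y" by (meson card_2_iff)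
  then show ?thesis using assms that[of x] that[of y] by (cases "e = x") blast+
qed

lemma cut_handshake:
  assumes "finite A" shows "2 * card (p ` A) = 2 * card {e \<in> C. e \<subseteq> p ` A} + card (cut C (p ` A))"
  using finite_C C_edges assms degree_two by (intro handshake_cut) auto

text \<open>A cut with at most one edge has, by parity, no edge at all, and connectedness then leaves no room for
  vertices in the arc. All structural facts below are obtained by showing that some cut is too small.\<close>

lemma cut_not_single:
  assumes "finite A" "cut C (p ` A) \<subseteq> {q}" shows "A = {}"
proof (rule ccontr)
  assume "A \<noteq> {}"
  moreover have "c \<notin> p ` A" using p_neq_c by auto
  ultimately have "cut C (p ` A) \<noteq> {}" by (intro connected_cut) auto
  then have "card (cut C (p ` A)) = 1" using assms(2) by (simp add: subset_singleton_iff)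
  then show False using cut_handshake[OF assms(1)] by presburger
qed

text \<open>The vertices on the other side of the chord from \<open>a\<close> to \<open>b\<close>; an edge from the arc below the chord to
  such a vertex crosses the chord.\<close>

definition far :: "int \<Rightarrow> int \<Rightarrow> 'a \<Rightarrow> bool" where
  "far a b w \<longleftrightarrow> w = c \<or> (\<exists>y. b < y \<and> y < a + m \<and> w = p y)"

lemma far_crosses:
  assumes "far a b w" "a \<le> i" "i < x" "x < j" "j \<le> b" "b - a \<le> h"
  shows "crs {p i, p j} {p x, w}"
proof (cases "w = c")
  case True
  then show ?thesis using assms spoke_crosses[of i x j] by (simp add: insert_commute)
next
  case False
  then obtain y where "b < y" "y < a + m" "w = p y" using assms(1) by (auto simp: far_def)
  then show ?thesis using assms chords_cross[of i x j y] by simp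
qed

lemma far_notin:
  assumes "far a b w" "a \<le> i" "i \<le> b" shows "w \<noteq> p i"
  using assms p_neq_c by (auto simp: far_def dest!: p_inj)

text \<open>Suppose that only the edge \<open>g\<close> at \<open>p a\<close> and the crossing edge \<open>{p x, w}\<close> leave the arc below the chord
  \<open>{p a, p b}\<close>. An edge that joins the two sides of \<open>x\<close> within the arc would be a second crossing of
  \<open>{p x, w}\<close>. So the points strictly between \<open>x\<close> and \<open>b\<close> are attached to the rest of the cycle at most
  by the second edge at \<open>p x\<close>. That is a cut with at most one edge, and there are no such points.\<close>

lemma hook_left:
  assumes e: "{p a, p b} \<in> C" and b: "b - a \<le> h" and f: "{p x, w} \<in> C" and x: "a < x" "x < b"
    and w: "far a b w" and g: "g \<in> C" "g \<noteq> {p a, p b}" "p a \<in> g"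
    and cut: "cut C (p ` {a<..<b}) = {g, {p x, w}}"
  shows "x = b - 1 \<and> cut C (p ` {a..b - 1}) = {{p a, p b}, {p x, w}}"
proof -
  let ?e = "{p a, p b}" and ?f = "{p x, w}"
  note near = m_eq h_ge b x
  have ef: "crs ?e ?f" using far_crosses[OF w, of a x b] x b by simp
  have no_f: "p j \<notin> ?f" if "a \<le> j" "j \<le> b" "j \<noteq> x" for j
    using far_notin[OF w that(1,2)] that near by (auto simp: p_eq_near)
  have fe: "?f \<noteq> ?e" using no_f[of a] x by auto
  obtain d where d: "d \<in> C" "\<And>k. k \<in> C \<Longrightarrow> p x \<in> k \<Longrightarrow> k = ?f \<or> k = d"
    by (rule other_edge[OF f, of "p x"]) auto
  have "cut C (p ` {x<..<b}) \<subseteq> {d}"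
  proof
    fix k assume k: "k \<in> cut C (p ` {x<..<b})"
    then obtain j where j: "x < j" "j < b" "p j \<in> k" by (auto simp: cut_def)
    have kC: "k \<in> C" using k by (auto simp: cut_def)
    then obtain v where v: "k = {p j, v}" "v \<noteq> p j" "v \<in> insert c (range p)" using edge_at[OF _ j(3)] by metis
    have kf: "k \<noteq> ?f" using no_f[of j] j x by auto
    have pjI: "p j \<in> p ` {a<..<b}" using j x by auto
    have leave: "v = p a" if "v \<notin> p ` {a<..<b}"
    proof -
      have "k \<in> cut C (p ` {a<..<b})" using that pjI kC v by (auto simp: cut_def)
      then have "k = g" using cut kf by auto
      then show ?thesis using g(3) v j near by (auto simp: p_eq_near)
    qed
    have no_cross: False if "a \<le> i" "i < x" "v = p i" for i
    proof -
      have "crs k ?f" using far_crosses[OF w, of i x j] that j b v(1) by (simp add: insert_commute)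
      moreover have "k \<noteq> ?e" using v(1) j x near by (auto simp: doubleton_eq_iff p_eq_near)
      ultimately show False using crossed_once[OF f kC e] kf fe ef crs_sym by blast
    qed
    show "k \<in> {d}"
    proof (cases "v \<in> p ` {a<..<b}")
      case False then show ?thesis using leave no_cross[of a] x by auto
    next
      case True
      then obtain i where i: "v = p i" "a < i" "i < b" by auto
      have "\<not> x < i" using k v(1) i j by (auto simp: cut_def)
      then have "i = x" using no_cross[of i] i by force
      then show ?thesis using d(2)[OF kC] kf v i by auto
    qed
  qed
  then have "{x<..<b} = {}" by (intro cut_not_single) auto
  then have "x + 1 \<notin> {x<..<b}" by blast
  then have xb: "x = b - 1" using x by simp
  have arc: "p ` {a..b - 1} = insert (p a) (p ` {a<..<b})"
  proof -
    have "{a..b - 1} = insert a {a<..<b}" using x by auto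
    then show ?thesis by simp
  qed
  obtain v where gv: "g = {p a, v}" using edge_at[OF g(1) g(3)] by metis
  have "g \<in> cut C (p ` {a<..<b})" using cut by auto
  moreover have "p a \<notin> p ` {a<..<b}" using near by (auto simp: p_eq_near)
  ultimately have gin: "g \<subseteq> p ` {a..b - 1}" unfolding arc gv by (auto simp: cut_def)
  have "cut C (p ` {a..b - 1}) = {?e, ?f}"
  proof
    show "cut C (p ` {a..b - 1}) \<subseteq> {?e, ?f}"
    proof
      fix k assume k: "k \<in> cut C (p ` {a..b - 1})"
      then have kC: "k \<in> C" and kg: "k \<noteq> g" using gin by (auto simp: cut_def)
      show "k \<in> {?e, ?f}"
      proof (cases "k \<inter> p ` {a<..<b} = {}")
        case True
        then have "p a \<in> k" using k unfolding arc cut_def by auto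
        moreover obtain g' where "\<And>k. k \<in> C \<Longrightarrow> p a \<in> k \<Longrightarrow> k = ?e \<or> k = g'"
          by (rule other_edge[OF e, of "p a"]) auto
        ultimately show ?thesis using g kg kC by (metis insertI1)
      next
        case False
        then have "k \<in> cut C (p ` {a<..<b})" using k unfolding arc cut_def by auto
        then show ?thesis using cut kg by auto
      qed
    qed
    have "p b \<notin> p ` {a..b - 1}" using near by (auto simp: p_eq_near)
    moreover have "w \<notin> p ` {a..b - 1}" using far_notin[OF w] by force
    ultimately show "{?e, ?f} \<subseteq> cut C (p ` {a..b - 1})" using e f x by (auto simp: cut_def)
  qed
  then show ?thesis using xb by simp
qed

lemma reflected: "one_plane_wheel_cycle (\<lambda>i. p (- i)) c m h C crs"
proof -
  have r: "range (\<lambda>i. p (- i)) = range p"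
    using image_image[of p uminus UNIV] by simp
  show ?thesis
  proof (unfold_locales, unfold r)
    fix a b x y :: int
    show "p (- a) = p (- b) \<longleftrightarrow> m dvd a - b"
      using dvd_minus_iff[of m "a - b"] by (simp add: p_eq_iff)
    show "crs {p (- a), p (- b)} {p (- x), p (- y)}" if "a < x" "x < b" "b < y" "y < a + m"
      using chords_cross[of "- b" "- x" "- a" "m - y"] that p_shift(2)[of "m - y"]
      by (simp add: insert_commute)
    show "crs {p (- a), p (- b)} {c, p (- x)}" if "a < x" "x < b" "b - a \<le> h"
      using spoke_crosses[of "- b" "- x" "- a"] that by (simp add: insert_commute)
  qed (fact m_eq h_ge p_neq_c finite_C C_edges degree_two connected_cut crs_sym crossed_once)+
qed

lemma hook_right:
  assumes e: "{p a, p b} \<in> C" and b: "b - a \<le> h" and f: "{p x, w} \<in> C" and x: "a < x" "x < b"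
    and w: "far a b w" and g: "g \<in> C" "g \<noteq> {p a, p b}" "p b \<in> g"
    and cut: "cut C (p ` {a<..<b}) = {g, {p x, w}}"
  shows "x = a + 1 \<and> cut C (p ` {a + 1..b}) = {{p a, p b}, {p x, w}}"
proof -
  interpret R: one_plane_wheel_cycle "\<lambda>i. p (- i)" c m h C crs by (rule reflected)
  have w': "R.far (- b) (- a) w"
  proof (cases "w = c")
    case False
    then obtain y where "b < y" "y < a + m" "w = p y" using w by (auto simp: far_def)
    then have "- a < m - y \<and> m - y < - b + m \<and> w = p (- (m - y))" using p_shift(2)[of y] by simp
    then show ?thesis unfolding R.far_def by blast
  qed (simp add: R.far_def)
  have neg: "(\<lambda>i. p (- i)) ` {- v<..<- u} = p ` {u<..<v}" "(\<lambda>i. p (- i)) ` {- v..- u} = p ` {u..v}" for u v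
    using image_image[of p uminus "{- v<..<- u}"] image_image[of p uminus "{- v..- u}"] by auto
  have "- x = - a - 1 \<and> cut C ((\<lambda>i. p (- i)) ` {- b..- a - 1}) = {{p (- (- b)), p (- (- a))}, {p (- (- x)), w}}"
    by (rule R.hook_left[where g = g]) (use e b f x w' g cut neg(1)[of b a] in \<open>simp_all add: insert_commute\<close>)
  moreover from this have "x = a + 1" by simp
  moreover have "(\<lambda>i. p (- i)) ` {- b..- a - 1} = p ` {a + 1..b}"
    using neg(2)[of b "a + 1"] by simp
  ultimately show ?thesis by (auto simp: insert_commute add.commute)
qed

text \<open>At most three edges leave the open arc below the chord: one at each end of the chord and one that crosses
  it. If none crossed, the chord and its arc would close up to a short cycle. So one crosses, and by parity
  exactly one of the other two is present.\<close>

lemma chord_hook: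
  assumes e: "{p a, p b} \<in> C" and ab: "a + 2 \<le> b" "b - a \<le> h"
  obtains x w where "{p x, w} \<in> C" "crs {p a, p b} {p x, w}" "{p x, w} \<noteq> {p a, p b}" "far a b w"
    "(x = b - 1 \<and> cut C (p ` {a..b - 1}) = {{p a, p b}, {p x, w}})
     \<or> (x = a + 1 \<and> cut C (p ` {a + 1..b}) = {{p a, p b}, {p x, w}})"
proof -
  let ?e = "{p a, p b}" and ?I = "p ` {a<..<b}"
  note near = m_eq h_ge ab
  obtain \<alpha> where \<alpha>: "\<alpha> \<in> C" "\<alpha> \<noteq> ?e" "p a \<in> \<alpha>" "\<And>k. k \<in> C \<Longrightarrow> p a \<in> k \<Longrightarrow> k = ?e \<or> k = \<alpha>"
    by (rule other_edge[OF e, of "p a"]) auto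
  obtain \<beta> where \<beta>: "\<beta> \<in> C" "\<beta> \<noteq> ?e" "p b \<in> \<beta>" "\<And>k. k \<in> C \<Longrightarrow> p b \<in> k \<Longrightarrow> k = ?e \<or> k = \<beta>"
    by (rule other_edge[OF e, of "p b"]) auto
  obtain va where va: "\<alpha> = {p a, va}" using edge_at[OF \<alpha>(1,3)] by metis
  obtain vb where vb: "\<beta> = {p b, vb}" using edge_at[OF \<beta>(1,3)] by metis
  have \<alpha>\<beta>: "\<alpha> \<noteq> \<beta>" 
  proof
    assume "\<alpha> = \<beta>"
    then have "p b \<in> {p a, va}" using \<beta>(3) va by simp
    then have "va = p b" using near by (auto simp: p_eq_near)
    then show False using va \<alpha>(2) by simp
  qed
  have leave: "k = \<alpha> \<or> k = \<beta> \<or> (\<exists>x w. k = {p x, w} \<and> a < x \<and> x < b \<and> far a b w)" if k: "k \<in> cut C ?I" for k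
  proof -
    obtain x where x: "a < x" "x < b" "p x \<in> k" using k by (auto simp: cut_def)
    have kC: "k \<in> C" using k by (auto simp: cut_def)
    obtain w where w: "k = {p x, w}" "w \<in> insert c (range p)" using edge_at[OF kC x(3)] by metis
    have wI: "w \<notin> ?I" using k w x by (auto simp: cut_def)
    have ke: "k \<noteq> ?e" using w x near by (auto simp: doubleton_eq_iff p_eq_near)
    from w(2) show ?thesis
    proof (cases rule: vertex_cases[where a = a])
      case 1
      then show ?thesis using w x by (auto simp: far_def)
    next
      case (2 j)
      then have "\<not> (a < j \<and> j < b)" using wI by auto
      then have "j = a \<or> j = b \<or> b < j" using \<open>a \<le> j\<close> by linarith
      then consider "j = a" | "j = b" | "b < j" by blast
      then show ?thesis
      proof cases
        case 1
        then have "p a \<in> k" using \<open>w = p j\<close> w by simp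
        then show ?thesis using \<alpha>(4)[OF kC] ke by blast
      next
        case 2
        then have "p b \<in> k" using \<open>w = p j\<close> w by simp
        then show ?thesis using \<beta>(4)[OF kC] ke by blast
      next
        case 3
        then have "far a b w" using \<open>w = p j\<close> \<open>j < a + m\<close> by (auto simp: far_def)
        then show ?thesis using w x by blast
      qed
    qed
  qed
  have farC: "k \<in> C \<and> k \<noteq> ?e \<and> crs ?e k \<and> k \<noteq> \<alpha> \<and> k \<noteq> \<beta>"
    if "k \<in> cut C ?I" "k = {p x, w}" "a < x" "x < b" "far a b w" for k x w
  proof -
    have "p a \<notin> k" "p b \<notin> k" using that far_notin[OF that(5), of a] far_notin[OF that(5), of b] near
      by (auto simp: p_eq_near)
    then show ?thesis using that far_crosses[of a b w a x b] ab \<alpha>(3) \<beta>(3) by (auto simp: cut_def)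
  qed
  \<comment> \<open>Otherwise the edges at both ends of the chord enter the arc, and the closed arc has an empty cut.\<close>
  have "\<exists>k x w. k \<in> cut C ?I \<and> k = {p x, w} \<and> a < x \<and> x < b \<and> far a b w"
  proof (rule ccontr)
    assume "\<not> ?thesis"
    then have sub: "cut C ?I \<subseteq> {\<alpha>, \<beta>}" using leave by blast
    have "a + 1 \<in> {a<..<b}" using ab by simp
    then have "\<not> cut C ?I \<subseteq> {q}" for q using cut_not_single[of "{a<..<b}" q] by blast
    then have "\<alpha> \<in> cut C ?I" "\<beta> \<in> cut C ?I" using sub by blast+
    moreover have "p a \<notin> ?I" "p b \<notin> ?I" using near by (auto simp: p_eq_near)
    ultimately have sub\<alpha>: "\<alpha> \<subseteq> p ` {a..b}" and sub\<beta>: "\<beta> \<subseteq> p ` {a..b}"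
      using va vb ab by (auto simp: cut_def)
    have arc: "p ` {a..b} = insert (p a) (insert (p b) ?I)"
    proof -
      have "{a..b} = insert a (insert b {a<..<b})" using ab by auto
      then show ?thesis by simp
    qed
    have "cut C (p ` {a..b}) = {}"
    proof -
      have False if k: "k \<in> cut C (p ` {a..b})" for k
      proof -
        have kC: "k \<in> C" and kn: "k \<noteq> \<alpha>" "k \<noteq> \<beta>" "k \<noteq> ?e"
          using k sub\<alpha> sub\<beta> ab by (auto simp: cut_def)
        have "p a \<notin> k" "p b \<notin> k" using \<alpha>(4)[OF kC] \<beta>(4)[OF kC] kn by auto
        then have "k \<in> cut C ?I" using k unfolding arc cut_def by auto
        then show False using sub kn by auto
      qed
      then show ?thesis by auto
    qed
    then have "{a..b} = {}" by (intro cut_not_single) auto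
    then show False using ab by simp
  qed
  then obtain f x w where f: "f \<in> cut C ?I" "f = {p x, w}" and x: "a < x" "x < b" and w: "far a b w"
    by auto
  note fC = farC[OF f x w]
  have only: "k = f" if k: "k \<in> cut C ?I" "k \<noteq> \<alpha>" "k \<noteq> \<beta>" for k
  proof -
    obtain x' w' where "k = {p x', w'}" "a < x'" "x' < b" "far a b w'" using leave[OF k(1)] k by auto
    then show ?thesis using farC[OF k(1)] fC crossed_once[OF e] by metis
  qed
  have not_all: "cut C ?I \<noteq> {\<alpha>, \<beta>, f}"
  proof
    assume "cut C ?I = {\<alpha>, \<beta>, f}"
    then have "card (cut C ?I) = 3" using \<alpha>\<beta> fC by (auto simp: card_insert_if)
    then show False using cut_handshake[OF finite_greaterThanLessThan_int, of a b] by presburger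
  qed
  have not_f: "cut C ?I \<noteq> {f}"
  proof
    assume "cut C ?I = {f}"
    then have "{a<..<b} = {}" by (intro cut_not_single) auto
    then show False using x by auto
  qed
  have "cut C ?I = {\<alpha>, f} \<or> cut C ?I = {\<beta>, f}"
  proof -
    define S where "S = cut C ?I"
    have sub: "S \<subseteq> {\<alpha>, \<beta>, f}" "f \<in> S" and S: "S \<noteq> {\<alpha>, \<beta>, f}" "S \<noteq> {f}"
      using only f(1) not_all not_f unfolding S_def by blast+
    have "\<not> (\<alpha> \<in> S \<and> \<beta> \<in> S)" using sub S(1) by blast
    moreover have "\<alpha> \<in> S \<or> \<beta> \<in> S" using sub S(2) by blast
    ultimately show ?thesis unfolding S_def[symmetric] using sub by blast
  qed
  then consider "cut C ?I = {\<alpha>, f}" | "cut C ?I = {\<beta>, f}" by blast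
  then show ?thesis
  proof cases
    case 1
    then show ?thesis using hook_left[of a b x w \<alpha>] that[of x w] e ab f x w \<alpha> fC by simp
  next
    case 2
    then show ?thesis using hook_right[of a b x w \<beta>] that[of x w] e ab f x w \<beta> fC by simp
  qed
qed

text \<open>The cycle enters and leaves the arc from \<open>a\<close> to \<open>x\<close> at its two ends, by two crossing chords that join
  each end to the point just beyond the other end.\<close>

definition block :: "int \<Rightarrow> int \<Rightarrow> bool" where
  "block a x \<longleftrightarrow> cut C (p ` {a..x}) = {{p a, p (x + 1)}, {p x, p (a - 1)}}"

text \<open>The variant of a block in which the edge that leaves at the last point goes to the centre.\<close>

definition spoked_left :: "int \<Rightarrow> int \<Rightarrow> bool" where
  "spoked_left a x \<longleftrightarrow> cut C (p ` {a..x}) = {{p a, p (x + 1)}, {p x, c}}"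

text \<open>The mirror image of the previous situation.\<close>

definition spoked_right :: "int \<Rightarrow> int \<Rightarrow> bool" where
  "spoked_right a x \<longleftrightarrow> cut C (p ` {a..x}) = {{p x, p (a - 1)}, {p a, c}}"

text \<open>If the crossing edge \<open>f\<close> is itself a chord, then the preceding analysis applies to \<open>f\<close> as well, and the two
  arcs obtained have both edges \<open>e\<close> and \<open>f\<close> in their cuts. In every configuration other than a block, one of
  these two edges lies inside the union of the arcs, whose cut would then have at most one edge.\<close>

lemma hook_shape:
  assumes e: "{p a, p b} \<in> C" and ab: "a + 2 \<le> b" "b - a \<le> h"
    and f: "{p (b - 1), w} \<in> C" "crs {p a, p b} {p (b - 1), w}" "{p (b - 1), w} \<noteq> {p a, p b}"
    and w: "far a b w" and cut: "cut C (p ` {a..b - 1}) = {{p a, p b}, {p (b - 1), w}}"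
  shows "block a (b - 1) \<or> spoked_left a (b - 1)"
proof (cases "w = c")
  case True
  then show ?thesis using cut by (simp add: spoked_left_def)
next
  case False
  let ?e = "{p a, p b}" and ?f = "{p (b - 1), w}"
  note near = m_eq h_ge ab
  obtain y where y: "b < y" "y < a + m" "w = p y" using False w by (auto simp: far_def)
  have partner: "g = ?e" if "g \<in> C" "crs ?f g" "g \<noteq> ?f" for g
    by (rule crossed_once[OF f(1) that(1) e that(3) f(3)[symmetric] that(2) crs_sym[OF f(2)]])
  have union: False if "cut C (p ` B) \<subseteq> {?e, ?f}" "finite B"
      "?e \<subseteq> p ` ({a..b - 1} \<union> B) \<or> ?f \<subseteq> p ` ({a..b - 1} \<union> B)" for B
  proof -
    have "cut C (p ` ({a..b - 1} \<union> B)) \<subseteq> {?e, ?f}"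
      using cut_Un[of C "p ` {a..b - 1}" "p ` B"] that(1) cut by (auto simp: image_Un)
    moreover have "?e \<notin> cut C (p ` ({a..b - 1} \<union> B)) \<or> ?f \<notin> cut C (p ` ({a..b - 1} \<union> B))"
      using that(3) by (auto simp: cut_def)
    ultimately have "cut C (p ` ({a..b - 1} \<union> B)) \<subseteq> {?e} \<or> cut C (p ` ({a..b - 1} \<union> B)) \<subseteq> {?f}"
      by blast
    then have "{a..b - 1} \<union> B = {}" using that(2) cut_not_single by (metis finite_UnI finite_atLeastAtMost_int)
    then show False using ab by auto
  qed
  show ?thesis
  proof (cases "y - (b - 1) \<le> h")
    case True
    have fy: "{p (b - 1), p y} \<in> C" "b - 1 + 2 \<le> y" using f y by auto
    obtain x' w' where g: "{p x', w'} \<in> C" "crs ?f {p x', w'}" "{p x', w'} \<noteq> ?f"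
      and cases: "(x' = y - 1 \<and> cut C (p ` {b - 1..y - 1}) = {?f, {p x', w'}})
       \<or> (x' = b - 1 + 1 \<and> cut C (p ` {b - 1 + 1..y}) = {?f, {p x', w'}})"
      unfolding y(3) by (rule chord_hook[OF fy True]) blast
    have ge: "{p x', w'} = ?e" using partner g by blast
    from cases show ?thesis
    proof
      assume *: "x' = y - 1 \<and> cut C (p ` {b - 1..y - 1}) = {?f, {p x', w'}}"
      have False by (rule union[of "{b - 1..y - 1}"]) (use * ge ab y in auto)
      then show ?thesis ..
    next
      assume *: "x' = b - 1 + 1 \<and> cut C (p ` {b - 1 + 1..y}) = {?f, {p x', w'}}"
      have False by (rule union[of "{b..y}"]) (use * ge ab y in auto)
      then show ?thesis ..
    qed
  next
    case False
    have fy: "{p (y - m), p (b - 1)} = ?f" using y by (simp add: p_shift insert_commute)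
    have far_side: "{p (y - m), p (b - 1)} \<in> C" "y - m + 2 \<le> b - 1" "b - 1 - (y - m) \<le> h"
      using f y False near fy by auto
    obtain x' w' where g: "{p x', w'} \<in> C" "crs ?f {p x', w'}" "{p x', w'} \<noteq> ?f"
      and cases: "(x' = b - 1 - 1 \<and> cut C (p ` {y - m..b - 1 - 1}) = {?f, {p x', w'}})
       \<or> (x' = y - m + 1 \<and> cut C (p ` {y - m + 1..b - 1}) = {?f, {p x', w'}})"
      by (rule chord_hook[OF far_side, unfolded fy]) blast
    have ge: "{p x', w'} = ?e" using partner g by blast
    from cases show ?thesis
    proof
      assume *: "x' = b - 1 - 1 \<and> cut C (p ` {y - m..b - 1 - 1}) = {?f, {p x', w'}}"
      have "?f \<subseteq> p ` ({a..b - 1} \<union> {y - m..b - 1 - 1})"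
        using y ab far_side(2) unfolding fy[symmetric] by auto
      then have False by (intro union[of "{y - m..b - 1 - 1}"]) (use * ge in auto)
      then show ?thesis ..
    next
      assume *: "x' = y - m + 1 \<and> cut C (p ` {y - m + 1..b - 1}) = {?f, {p x', w'}}"
      have "p (y - m + 1) = p a \<or> p (y - m + 1) = p b" using ge * by blast
      then have "y - m + 1 = a" using y near by (auto simp: p_eq_near)
      then have "w = p (a - 1)" using y p_shift(2)[of y] by (metis add_diff_cancel_right')
      then show ?thesis using cut by (simp add: block_def)
    qed
  qed
qed

lemma reflected_arc: "(\<lambda>i. p (- i)) ` {- x..- a} = p ` {a..x}"
  using image_image[of p uminus "{- x..- a}"] by auto

text \<open>All ways in which a 1-plane Hamiltonian cycle can use a chord that is not a side of the polygon.\<close>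

lemma chord_shape:
  assumes e: "{p a, p b} \<in> C" and ab: "a + 2 \<le> b" "b - a \<le> h"
  shows "block a (b - 1) \<or> block (a + 1) b \<or> spoked_left a (b - 1) \<or> spoked_right (a + 1) b"
proof -
  interpret R: one_plane_wheel_cycle "\<lambda>i. p (- i)" c m h C crs by (rule reflected)
  obtain x w where f: "{p x, w} \<in> C" "crs {p a, p b} {p x, w}" "{p x, w} \<noteq> {p a, p b}" "far a b w"
    and cases: "(x = b - 1 \<and> cut C (p ` {a..b - 1}) = {{p a, p b}, {p x, w}})
     \<or> (x = a + 1 \<and> cut C (p ` {a + 1..b}) = {{p a, p b}, {p x, w}})"
    by (rule chord_hook[OF assms]) blast
  from cases show ?thesis
  proof
    assume "x = b - 1 \<and> cut C (p ` {a..b - 1}) = {{p a, p b}, {p x, w}}"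
    then show ?thesis using hook_shape[OF assms] f by blast
  next
    assume *: "x = a + 1 \<and> cut C (p ` {a + 1..b}) = {{p a, p b}, {p x, w}}"
    have w': "R.far (- b) (- a) w"
    proof (cases "w = c")
      case False
      then obtain y where "b < y" "y < a + m" "w = p y" using f by (auto simp: far_def)
      then have "- a < m - y \<and> m - y < - b + m \<and> w = p (- (m - y))" using p_shift(2)[of y] by simp
      then show ?thesis unfolding R.far_def by blast
    qed (simp add: R.far_def)
    have eq: "(\<lambda>i. p (- i)) ` {- b..- a - 1} = p ` {a + 1..b}"
      using reflected_arc[of b "a + 1"] by simp
    have "R.block (- b) (- a - 1) \<or> R.spoked_left (- b) (- a - 1)"
    proof (rule R.hook_shape)
      have b1: "- (- a - 1) = a + 1" "- a - 1 = - (a + 1)" by simp_all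
      show "cut C ((\<lambda>i. p (- i)) ` {- b..- a - 1}) = {{p (- (- b)), p (- (- a))}, {p (- (- a - 1)), w}}"
        unfolding b1 reflected_arc using * by (auto simp: insert_commute add.commute)
    qed (use w' e ab f * in \<open>simp_all add: insert_commute add.commute\<close>)
    then show ?thesis
      unfolding R.block_def R.spoked_left_def block_def spoked_right_def
      by (simp add: eq insert_commute add.commute) blast
  qed
qed

section \<open>Every 1-plane Hamiltonian cycle has six tokens\<close>

definition side :: "int \<Rightarrow> bool" where "side i \<longleftrightarrow> {p i, p (i + 1)} \<in> C"

text \<open>At least two of the three edges in the triangle of \<open>p (i - 1)\<close>, \<open>p i\<close> and \<open>p (i + 1)\<close> are present.\<close>

definition apex :: "int \<Rightarrow> bool" where
  "apex i \<longleftrightarrow> (side (i - 1) \<and> side i) \<or> ({p (i - 1), p (i + 1)} \<in> C \<and> (side (i - 1) \<or> side i))"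

definition sides_in :: "int set \<Rightarrow> 'a set set" where
  "sides_in A = {{p i, p (i + 1)} |i. i \<in> A \<and> i + 1 \<in> A \<and> side i}"

definition apexes_in :: "int set \<Rightarrow> 'a set" where
  "apexes_in A = {p i |i. i \<in> A \<and> apex i}"

text \<open>The disjoint sum keeps the tokens for sides apart from the tokens for apexes.\<close>

definition tokens :: "int set \<Rightarrow> ('a set + 'a) set" where
  "tokens A = Inl ` sides_in A \<union> Inr ` apexes_in A"

lemma range_p: "range p = p ` {a..<a + m}"
proof -
  have "p i \<in> p ` {a..<a + m}" for i
    by (rule vertex_cases[of "p i", where a = a]) (use p_neq_c in auto)
  then show ?thesis by auto
qed

lemma finite_tokens: "finite (tokens A)"
proof -
  have "sides_in A \<subseteq> C" by (auto simp: side_def sides_in_def)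
  moreover have "apexes_in A \<subseteq> p ` {0..<0 + m}" using range_p[of 0] by (auto simp: apexes_in_def)
  ultimately show ?thesis using finite_C unfolding tokens_def
    by (meson finite_UnI finite_atLeastLessThan_int finite_imageI finite_subset)
qed

lemma tokens_mono: "A \<subseteq> B \<Longrightarrow> tokens A \<subseteq> tokens B"
  unfolding tokens_def sides_in_def apexes_in_def by (intro Un_mono image_mono) auto

lemma card_tokens_mono: "A \<subseteq> B \<Longrightarrow> card (tokens A) \<le> card (tokens B)"
  by (intro card_mono finite_tokens tokens_mono)

lemma three_tokens: "{u, v, w} \<subseteq> tokens A \<Longrightarrow> u \<noteq> v \<Longrightarrow> u \<noteq> w \<Longrightarrow> v \<noteq> w \<Longrightarrow> 3 \<le> card (tokens A)"
  using card_mono[OF finite_tokens, of "{u, v, w}" A] by simp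

lemma side_token: "side i \<Longrightarrow> i \<in> A \<Longrightarrow> i + 1 \<in> A \<Longrightarrow> Inl {p i, p (i + 1)} \<in> tokens A"
  unfolding tokens_def sides_in_def by (intro UnI1 imageI CollectI exI[of _ i]) simp

lemma apex_token: "apex i \<Longrightarrow> i \<in> A \<Longrightarrow> Inr (p i) \<in> tokens A"
  unfolding tokens_def apexes_in_def by (intro UnI2 imageI CollectI exI[of _ i]) simp

text \<open>In a block on two points, the side between them and the two chords form an apex at both points.\<close>

lemma short_block_tokens:
  assumes "block a (a + 1)" "side a"
  shows "3 \<le> card (tokens {a..a + 1})"
proof -
  have "{p a, p (a + 1 + 1)} \<in> C" "{p (a + 1), p (a - 1)} \<in> C"
    using assms(1) by (auto simp: block_def cut_def)
  then have "apex a" "apex (a + 1)" using assms(2) by (auto simp: apex_def insert_commute)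
  then show ?thesis
    using assms(2) side_token[of a "{a..a + 1}"] apex_token[of _ "{a..a + 1}"] m_eq h_ge
    by (intro three_tokens[of "Inl {p a, p (a + 1)}" "Inr (p a)" "Inr (p (a + 1))"]) (auto simp: p_eq_near)
qed

text \<open>The cycle runs through the arc from \<open>a\<close> to \<open>x\<close> without leaving it. If it uses a chord there, that
  chord belongs to a smaller block, because no spoke ends strictly inside the arc. Otherwise it walks along
  the sides, and three consecutive points already give two sides and an apex. The case of two
  points remains, where the number of tokens depends on the edges that leave the arc.\<close>

lemma arc_tokens:
  assumes "a < x" "x - a + 1 \<le> h" "cut C (p ` {a..x}) = {{p a, u}, {p x, w}}"
  shows "3 \<le> card (tokens {a..x}) \<or> (x = a + 1 \<and> side a)"
  using assms
proof (induction "nat (x - a)" arbitrary: a x u w rule: less_induct)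
  case less
  note ax = less.prems(1,2) and cut = less.prems(3)
  note near = m_eq h_ge ax
  have in_cut: "k = {p a, u} \<or> k = {p x, w}" if "k \<in> cut C (p ` {a..x})" for k using cut that by blast
  show ?case
  proof (cases "\<exists>i j. a \<le> i \<and> i + 2 \<le> j \<and> j \<le> x \<and> {p i, p j} \<in> C")
    case True
    then obtain i j where ij: "a \<le> i" "i + 2 \<le> j" "j \<le> x" and e: "{p i, p j} \<in> C" by blast
    have no_spoke: "{p l, c} \<notin> C" if "a < l" "l < x" for l
    proof
      assume "{p l, c} \<in> C"
      then have "{p l, c} \<in> cut C (p ` {a..x})" using that p_neq_c by (auto simp: cut_def)
      then have "p a \<in> {p l, c} \<or> p x \<in> {p l, c}" using in_cut by blast
      then show False using that p_neq_c near by (auto simp: p_eq_near)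
    qed
    have inner: "3 \<le> card (tokens {a..x})"
      if bl: "block a' x'" and sub: "a \<le> a'" "a' < x'" "x' \<le> x" "x' - a' < x - a" for a' x'
    proof -
      have "3 \<le> card (tokens {a'..x'}) \<or> (x' = a' + 1 \<and> side a')"
        by (rule less.hyps[of x' a']) (use bl sub ax in \<open>auto simp: block_def\<close>)
      then have "3 \<le> card (tokens {a'..x'})" using short_block_tokens bl by auto
      also have "\<dots> \<le> card (tokens {a..x})" using sub by (intro card_tokens_mono) auto
      finally show ?thesis .
    qed
    have "\<not> spoked_left i (j - 1)" "\<not> spoked_right (i + 1) j"
      using no_spoke[of "j - 1"] no_spoke[of "i + 1"] ij by (auto simp: spoked_left_def spoked_right_def cut_def)
    then have "block i (j - 1) \<or> block (i + 1) j" using chord_shape[OF e ij(2)] ij ax by auto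
    then show ?thesis using inner[of i "j - 1"] inner[of "i + 1" j] ij by auto
  next
    case False
    \<comment> \<open>A missing side would leave the first part of the arc attached by the edge at \<open>p a\<close> only.\<close>
    have all_sides: "side i" if i: "a \<le> i" "i < x" for i
    proof (rule ccontr)
      assume nh: "\<not> side i"
      have "cut C (p ` {a..i}) \<subseteq> {{p a, u}}"
      proof
        fix k assume k: "k \<in> cut C (p ` {a..i})"
        then obtain j where j: "a \<le> j" "j \<le> i" "p j \<in> k" by (auto simp: cut_def)
        have kC: "k \<in> C" using k by (auto simp: cut_def)
        obtain v where v: "k = {p j, v}" using edge_at[OF kC j(3)] by metis
        have "v \<notin> p ` {i<..x}"
        proof
          assume "v \<in> p ` {i<..x}"
          then obtain l where l: "i < l" "l \<le> x" "v = p l" by auto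
          show False
          proof (cases "l = j + 1")
            case True then have "j = i" using l j by simp
            then show False using nh True l v kC by (simp add: side_def)
          next
            case neq: False
            have "a \<le> j \<and> j + 2 \<le> l \<and> l \<le> x \<and> {p j, p l} \<in> C"
              using l j v kC neq by simp
            then show False using False by blast
          qed
        qed
        moreover have "v \<notin> p ` {a..i}" using k v j by (auto simp: cut_def)
        moreover have "{a..x} = {a..i} \<union> {i<..x}" using i by auto
        ultimately have "v \<notin> p ` {a..x}" by (simp add: image_Un)
        then have vk: "k \<in> cut C (p ` {a..x})" using k i v by (auto simp: cut_def)
        have "p x \<notin> k" using \<open>v \<notin> p ` {a..x}\<close> v j i near by (auto simp: p_eq_near)
        then show "k \<in> {{p a, u}}" using in_cut[OF vk] by auto
      qed
      then have "{a..i} = {}" by (intro cut_not_single) auto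
      then show False using i by auto
    qed
    show ?thesis
    proof (cases "x = a + 1")
      case True
      then show ?thesis using all_sides by simp
    next
      case False
      then have "side a" "side (a + 1)" using all_sides ax by auto
      moreover have "apex (a + 1)" using calculation by (simp add: apex_def)
      moreover have "{p a, p (a + 1)} \<noteq> {p (a + 1), p (a + 1 + 1)}"
        using near by (auto simp: doubleton_eq_iff p_eq_near)
      ultimately have "3 \<le> card (tokens {a..x})"
        using side_token[of a "{a..x}"] side_token[of "a + 1" "{a..x}"] apex_token[of "a + 1" "{a..x}"] False ax
        by (intro three_tokens[of "Inl {p a, p (a + 1)}" "Inl {p (a + 1), p (a + 1 + 1)}" "Inr (p (a + 1))"]) auto
      then show ?thesis ..
    qed
  qed
qed

lemma block_tokens:
  assumes "block a x" "a < x" "x - a + 1 \<le> h"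
  shows "3 \<le> card (tokens {a..x})"
proof -
  have "3 \<le> card (tokens {a..x}) \<or> (x = a + 1 \<and> side a)"
    using assms by (intro arc_tokens) (auto simp: block_def)
  then show ?thesis using assms(1) short_block_tokens by auto
qed

text \<open>The smaller of the two arcs between the ends is chosen.\<close>

lemma rim_chord:
  assumes "e \<in> C" "c \<notin> e" "\<And>i. e \<noteq> {p i, p (i + 1)}"
  obtains i j where "e = {p i, p j}" "i + 2 \<le> j" "j - i \<le> h"
proof -
  have "e \<noteq> {}" using assms(1) C_edges by (auto simp: nsets_def)
  then obtain u where u: "u \<in> e" by auto
  have "e \<subseteq> insert c (range p)" using assms(1) C_edges unfolding nsets_def by blast
  then obtain i where i: "u = p i" using u assms(2) by blast
  obtain w where w: "e = {p i, w}" "w \<noteq> p i" "w \<in> insert c (range p)" using edge_at[OF assms(1) u] i by metis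
  obtain j where j: "i \<le> j" "j < i + m" "w = p j" using vertex_cases[OF w(3), where a = i] w assms(2) by auto
  have ij: "j \<noteq> i" "j \<noteq> i + 1" "j - m + 1 \<noteq> i" using w j assms(3)[of i] assms(3)[of "j - m"] p_shift by (auto simp: insert_commute)
  show ?thesis
  proof (cases "j - i \<le> h")
    case True then show ?thesis using that[of i j] w j ij by auto
  next
    case False
    have "p (j - m) = p j" by (rule p_shift)
    then have "e = {p (j - m), p i}" using w(1) j(3) by (simp add: insert_commute)
    then show ?thesis using that[of "j - m" i] j ij False m_eq by simp
  qed
qed

lemma spoke_crossed_once:
  assumes "{c, p q} \<in> C" "e \<in> C" "g \<in> C" "crs e {c, p q}" "crs g {c, p q}" "c \<notin> e" "c \<notin> g"
  shows "e = g"
  using crossed_once[OF assms(1-3) _ _ crs_sym[OF assms(4)] crs_sym[OF assms(5)]] assms(6,7) by auto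

lemma chord_spoked:
  assumes "{p i, p j} \<in> C" "i + 2 \<le> j" "j - i \<le> h"
  obtains "block i (j - 1)" | "block (i + 1) j" 
  | "{c, p (j - 1)} \<in> C" "crs {p i, p j} {c, p (j - 1)}" "spoked_left i (j - 1)"
  | "{c, p (i + 1)} \<in> C" "crs {p i, p j} {c, p (i + 1)}" "spoked_right (i + 1) j"
proof -
  have "{c, p (j - 1)} \<in> C" if "spoked_left i (j - 1)"
    using that by (auto simp: spoked_left_def cut_def insert_commute)
  moreover have "{c, p (i + 1)} \<in> C" if "spoked_right (i + 1) j"
    using that by (auto simp: spoked_right_def cut_def insert_commute)
  moreover have "crs {p i, p j} {c, p (j - 1)}" "crs {p i, p j} {c, p (i + 1)}"
    using spoke_crosses assms by auto
  ultimately show ?thesis using chord_shape[OF assms] that by blast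
qed

text \<open>These are the chords within an arc that are not sides of the polygon.\<close>

definition nonside :: "int set \<Rightarrow> 'a set set" where
  "nonside A = {e \<in> C. e \<subseteq> p ` A \<and> (\<forall>i. e \<noteq> {p i, p (i + 1)})}"

lemma spokes: "card {e \<in> C. c \<in> e} = 2" "finite {e \<in> C. c \<in> e}"
  using degree_two[of c] finite_C by auto

text \<open>There are two spokes in the cycle and each of them is crossed at most once.\<close>

lemma card_nonside_le:
  assumes "\<And>e. e \<in> nonside A \<Longrightarrow> \<exists>q. {c, p q} \<in> C \<and> crs e {c, p q}"
  shows "card (nonside A) \<le> 2"
proof -
  obtain q where q: "\<And>e. e \<in> nonside A \<Longrightarrow> {c, p (q e)} \<in> C \<and> crs e {c, p (q e)}"
    using assms by metis
  have "inj_on (\<lambda>e. {c, p (q e)}) (nonside A)"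
  proof (rule inj_onI)
    fix e g assume eg: "e \<in> nonside A" "g \<in> nonside A" and same: "{c, p (q e)} = {c, p (q g)}"
    have "c \<notin> p ` A" using p_neq_c by auto
    then have "c \<notin> e" "c \<notin> g" "e \<in> C" "g \<in> C" using eg by (auto simp: nonside_def)
    then show "e = g" using spoke_crossed_once[of "q e" e g] q[OF eg(1)] q[OF eg(2)] same by simp
  qed
  then have "card (nonside A) \<le> card {e \<in> C. c \<in> e}"
    using q spokes(2) by (intro card_inj_on_le) auto
  then show ?thesis using spokes(1) by simp
qed

text \<open>The hypothesis says that two corners in \<open>A\<close> that are adjacent on the rim have adjacent indices in
  \<open>A\<close>; it fails only for an arc that closes up around the rim without being represented so by its indices.\<close>

lemma card_edges_le:
  assumes "\<And>i. p i \<in> p ` A \<Longrightarrow> p (i + 1) \<in> p ` A \<Longrightarrow> \<exists>j. j \<in> A \<and> j + 1 \<in> A \<and> p j = p i \<and> p (j + 1) = p (i + 1)"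
  shows "card {e \<in> C. e \<subseteq> p ` A} \<le> card (sides_in A) + card (nonside A)"
proof -
  have fT: "finite (sides_in A)" using finite_C by (rule rev_finite_subset) (auto simp: side_def sides_in_def)
  have "e \<in> sides_in A" if e: "e \<in> C" "e \<subseteq> p ` A" "e = {p i, p (i + 1)}" for e i
  proof -
    obtain j where j: "j \<in> A" "j + 1 \<in> A" "p j = p i" "p (j + 1) = p (i + 1)" using assms[of i] e(2,3) by auto
    then have "e = {p j, p (j + 1)} \<and> j \<in> A \<and> j + 1 \<in> A \<and> side j" using e(1,3) by (simp add: side_def)
    then show ?thesis unfolding sides_in_def by blast
  qed
  then have "{e \<in> C. e \<subseteq> p ` A} \<subseteq> sides_in A \<union> nonside A" unfolding nonside_def by blast
  then have "card {e \<in> C. e \<subseteq> p ` A} \<le> card (sides_in A \<union> nonside A)"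
    using fT finite_C by (intro card_mono) (auto simp: nonside_def)
  also have "\<dots> \<le> card (sides_in A) + card (nonside A)" by (rule card_Un_le)
  finally show ?thesis .
qed

lemma card_tokens: "card (tokens A) = card (sides_in A) + card (apexes_in A)"
proof -
  have "finite (Inl ` sides_in A :: ('a set + 'a) set)" "finite (Inr ` apexes_in A :: ('a set + 'a) set)"
    using finite_tokens[of A] unfolding tokens_def by simp_all
  then show ?thesis unfolding tokens_def
    by (subst card_Un_disjoint) (auto simp: card_image)
qed

text \<open>Without blocks all chords other than sides are crossed by spokes, so at most two of the \<open>m - 1\<close> rim edges
  are not sides.\<close>

lemma six_tokens_if_no_block:
  assumes "\<And>a x. a < x \<Longrightarrow> x - a + 1 \<le> h \<Longrightarrow> \<not> block a x"
  shows "6 \<le> card (tokens UNIV)"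
proof -
  have V: "range p = p ` {0..<m}" using range_p[of 0] by simp
  have inj: "inj_on p {0..<m}" by (rule inj_onI) (auto dest!: p_inj)
  have cV: "card (p ` {0..<m}) = nat m" using card_image[OF inj] by simp
  have "cut C (range p) = {e \<in> C. c \<in> e}"
  proof -
    have "e \<inter> range p \<noteq> {} \<and> \<not> e \<subseteq> range p \<longleftrightarrow> c \<in> e" if "e \<in> C" for e
    proof -
      have "e \<in> nsets (insert c (range p)) 2" using that C_edges by blast
      then obtain u v where "e = {u, v}" "u \<in> insert c (range p)" "v \<in> insert c (range p)" "u \<noteq> v"
        by (rule nsets2_E)
      then show ?thesis using p_neq_c by auto
    qed
    then show ?thesis by (auto simp: cut_def)
  qed
  then have E: "2 * nat m = 2 * card {e \<in> C. e \<subseteq> p ` UNIV} + 2"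
    using cut_handshake[of "{0..<m}"] cV spokes(1) V by simp
  have "card (nonside UNIV) \<le> 2"
  proof (rule card_nonside_le)
    fix e assume e: "e \<in> nonside UNIV"
    then have "c \<notin> e" using p_neq_c by (auto simp: nonside_def)
    then obtain i j where ij: "e = {p i, p j}" "i + 2 \<le> j" "j - i \<le> h"
      using rim_chord[of e] e by (auto simp: nonside_def)
    have "{p i, p j} \<in> C" using e ij by (simp add: nonside_def)
    then show "\<exists>q. {c, p q} \<in> C \<and> crs e {c, p q}"
      using assms[of i "j - 1"] assms[of "i + 1" j] ij by (elim chord_spoked) auto
  qed
  moreover have "card {e \<in> C. e \<subseteq> p ` UNIV} \<le> card (sides_in UNIV) + card (nonside UNIV)"
    by (rule card_edges_le) auto
  ultimately show ?thesis using E m_eq h_ge unfolding card_tokens by linarith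
qed

lemma longest_block:
  assumes "block a0 x0" "a0 < x0" "x0 - a0 + 1 \<le> h"
  obtains a x where "block a x" "a < x" "x - a + 1 \<le> h"
    "\<And>a' x'. block a' x' \<Longrightarrow> a' < x' \<Longrightarrow> x' - a' + 1 \<le> h \<Longrightarrow> x' - a' \<le> x - a"
proof -
  define Q where "Q z = (case z of (a, x) \<Rightarrow> block a x \<and> a < x \<and> x - a + 1 \<le> h)" for z
  define len where "len z = (case z of (a, x) \<Rightarrow> nat (x - a))" for z :: "int \<times> int"
  have "Q (a0, x0)" using assms by (simp add: Q_def)
  moreover have "\<forall>z. Q z \<longrightarrow> len z < nat h" by (auto simp: Q_def len_def)
  ultimately obtain z where z: "Q z" "\<And>y. Q y \<Longrightarrow> len y \<le> len z"
    using ex_has_greatest_nat[of Q _ len] by blast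
  obtain a x where "z = (a, x)" by (cases z)
  then show ?thesis using that[of a x] z unfolding Q_def len_def by force
qed

text \<open>The points outside the block number \<open>m - (x - a + 1)\<close>. Their cut consists of the two chords of the
  block and the two spokes, so the number of edges among them is smaller by two.\<close>

lemma complement_edges:
  assumes bl: "block a x" and ax: "a < x" "x - a + 1 \<le> h"
  shows "nat (m - (x - a + 1)) \<le> card {e \<in> C. e \<subseteq> p ` {x + 1..a - 1 + m}} + 2"
proof -
  let ?R = "{x + 1..a - 1 + m}"
  let ?e = "{p a, p (x + 1)}" and ?f = "{p x, p (a - 1)}"
  have "inj_on p ?R" by (rule inj_onI) (use ax in \<open>auto dest!: p_inj\<close>)
  then have cR: "card (p ` ?R) = nat (m - (x - a + 1))" by (simp add: card_image)
  have "cut C (p ` ?R) \<subseteq> {?e, ?f} \<union> {g \<in> C. c \<in> g}"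
  proof
    fix k assume k: "k \<in> cut C (p ` ?R)"
    then have "k \<inter> p ` ?R \<noteq> {}" by (simp add: cut_def)
    then obtain i where iR: "i \<in> ?R" "p i \<in> k" by blast
    then have i: "x < i" "i < a + m" "p i \<in> k" by auto
    have kC: "k \<in> C" using k by (auto simp: cut_def)
    obtain v where v: "k = {p i, v}" "v \<in> insert c (range p)" using edge_at[OF kC i(3)] by metis
    have vR: "v \<notin> p ` ?R" using k v i by (auto simp: cut_def)
    from v(2) show "k \<in> {?e, ?f} \<union> {g \<in> C. c \<in> g}"
    proof (cases rule: vertex_cases[where a = a])
      case 1 then show ?thesis using v kC by auto
    next
      case (2 j)
      have "j \<notin> ?R" using vR 2(3) by blast
      then have "j \<in> {a..x}" using 2(1,2) by auto
      moreover have "p i \<notin> p ` {a..x}" using i ax by (auto dest!: p_inj)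
      ultimately have "k \<in> cut C (p ` {a..x})" using v(1) 2(3) kC by (auto simp: cut_def)
      then show ?thesis using bl by (auto simp: block_def)
    qed
  qed
  then have "card (cut C (p ` ?R)) \<le> card ({?e, ?f} \<union> {g \<in> C. c \<in> g})"
    using spokes(2) by (intro card_mono) auto
  also have "\<dots> \<le> card {?e, ?f} + card {g \<in> C. c \<in> g}" by (rule card_Un_le)
  also have "\<dots> \<le> 4" using spokes(1) by (simp add: card_insert_if)
  finally show ?thesis using cut_handshake[of ?R] cR by simp
qed

text \<open>Consider a chord outside the block that is not a side. If it belonged to a block outside, this would
  provide the tokens; and a block that surrounds the given one is excluded by maximality. So a spoke
  crosses it. If its short arc lies outside the given block, then either that arc alone has three tokens,
  or the chord spans just two steps and its middle point is an apex where the spoke ends. In the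
  latter case every edge outside the block, side or not, gives a token of its own.
  If instead its short arc surrounds the block, the block is so short that there are at least seven
  points outside; the at most two chords can then be disregarded.\<close>

lemma complement_tokens:
  assumes bl: "block a x" and ax: "a < x" "x - a + 1 \<le> h"
    and longest: "\<And>a' x'. block a' x' \<Longrightarrow> a' < x' \<Longrightarrow> x' - a' + 1 \<le> h \<Longrightarrow> x' - a' \<le> x - a"
  shows "3 \<le> card (tokens {x + 1..a - 1 + m})"
proof (rule ccontr)
  let ?R = "{x + 1..a - 1 + m}"
  assume few: "\<not> 3 \<le> card (tokens ?R)"
  define k where "k = m - (x - a + 1)"
  have no_sub: "\<not> 3 \<le> card (tokens A)" if "A \<subseteq> ?R" for A
    using few card_tokens_mono[OF that] by linarith
  have no_spoke: "{c, p l} \<notin> C" if "a \<le> l" "l \<le> x" for l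
  proof
    assume "{c, p l} \<in> C"
    then have "{c, p l} \<in> cut C (p ` {a..x})" using that p_neq_c by (auto simp: cut_def)
    then have "c \<in> {p a, p (x + 1)} \<or> c \<in> {p x, p (a - 1)}" using bl by (auto simp: block_def)
    then show False using p_neq_c by auto
  qed
  have spoked: "\<exists>q. {c, p q} \<in> C \<and> crs e {c, p q} \<and> (k < 7 \<longrightarrow> q \<in> ?R \<and> apex q)"
    if e: "e \<in> nonside ?R" for e
  proof -
    have eC: "e \<in> C" and eR: "e \<subseteq> p ` ?R" and ns: "\<And>i. e \<noteq> {p i, p (i + 1)}"
      using e by (auto simp: nonside_def)
    obtain i j where ij: "e = {p i, p j}" "i < j" "i \<in> ?R" "j \<in> ?R"
    proof -
      have "e \<in> nsets (insert c (range p)) 2" using eC C_edges by blast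
      then obtain u v where uv: "e = {u, v}" "u \<noteq> v" by (rule nsets2_E)
      then obtain i j where "u = p i" "v = p j" "i \<in> ?R" "j \<in> ?R" using eR by auto
      then show ?thesis using that[of i j] that[of j i] uv by (cases i j rule: linorder_cases) auto
    qed
    have far: "i + 2 \<le> j" using ns[of i] ij by (cases "j = i + 1") auto
    have eC': "{p i, p j} \<in> C" using eC ij by simp
    show ?thesis
    proof (cases "j - i \<le> h")
      case short: True
      have no_block: "\<not> block a' x'" if "a' < x'" "x' - a' + 1 \<le> h" "i \<le> a'" "x' \<le> j" for a' x'
      proof
        assume "block a' x'"
        then have "3 \<le> card (tokens {a'..x'})" using block_tokens that by simp
        then show False using no_sub[of "{a'..x'}"] that ij by auto
      qed
      from eC' far short show ?thesis
      proof (cases rule: chord_spoked)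
        case 1 then show ?thesis using no_block[of i "j - 1"] far short by simp
      next
        case 2 then show ?thesis using no_block[of "i + 1" j] far short by simp
      next
        case 3
        have "3 \<le> card (tokens {i..j - 1}) \<or> (j - 1 = i + 1 \<and> side i)"
          using 3(3) far short by (intro arc_tokens) (auto simp: spoked_left_def)
        then have "j - 1 = i + 1 \<and> side i" using no_sub[of "{i..j - 1}"] ij by auto
        then have "j - 1 \<in> ?R \<and> apex (j - 1)" using eC' ij by (auto simp: apex_def)
        then show ?thesis using 3 ij(1) by blast
      next
        case 4
        have "cut C (p ` {i + 1..j}) = {{p (i + 1), c}, {p j, p (i + 1 - 1)}}"
          using 4(3) by (simp add: spoked_right_def insert_commute)
        then have "3 \<le> card (tokens {i + 1..j}) \<or> (j = i + 1 + 1 \<and> side (i + 1))"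
          using far short by (intro arc_tokens) auto
        then have "j = i + 1 + 1 \<and> side (i + 1)" using no_sub[of "{i + 1..j}"] ij by auto
        then have "i + 1 \<in> ?R \<and> apex (i + 1)" using eC' ij by (auto simp: apex_def)
        then show ?thesis using 4 ij(1) by blast
      qed
    next
      case long: False
      have pj: "p (j - m) = p j" by (rule p_shift)
      have e': "e = {p (j - m), p i}" using ij pj by (simp add: insert_commute)
      have C': "{p (j - m), p i} \<in> C" using eC e' by simp
      have l: "j - m + 2 \<le> i" "i - (j - m) \<le> h" using ij ax long m_eq by auto
      \<comment> \<open>The arc surrounds the block with at least three additional steps, hence the block has at most \<open>h - 2\<close> points.\<close>
    have k7: "7 \<le> k" if "x + 3 - a \<le> h" using that m_eq h_ge by (simp add: k_def)
      from C' l show ?thesis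
      proof (cases rule: chord_spoked)
        case 1 then show ?thesis using longest[of "j - m" "i - 1"] l ij by auto
      next
        case 2 then show ?thesis using longest[of "j - m + 1" i] l ij by auto
      next
        case 3
        then have "i - 1 \<noteq> x" using no_spoke[of "i - 1"] ax by auto
        then have "7 \<le> k" using k7 l ij by auto
        then show ?thesis using 3 e' by auto
      next
        case 4
        then have "j - m + 1 \<noteq> a" using no_spoke[of "j - m + 1"] ax by auto
        then have "7 \<le> k" using k7 l ij by auto
        then show ?thesis using 4 e' by auto
      qed
    qed
  qed
  then have ns2: "card (nonside ?R) \<le> 2" by (intro card_nonside_le) blast
  have edges: "card {e \<in> C. e \<subseteq> p ` ?R} \<le> card (sides_in ?R) + card (nonside ?R)"
  proof (rule card_edges_le)
    fix i assume "p i \<in> p ` ?R" "p (i + 1) \<in> p ` ?R"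
    then obtain j l where j: "j \<in> ?R" "p i = p j" and l: "l \<in> ?R" "p (i + 1) = p l" by auto
    have j1: "p (j + 1) = p (i + 1)" using j(2) by (simp add: p_eq_iff) (metis dvd_diff_commute)
    have "j + 1 \<in> ?R"
    proof (rule ccontr)
      assume "j + 1 \<notin> ?R"
      then have "j + 1 = a + m" using j(1) by auto
      then have "p l = p a" using j1 l(2) p_shift(1)[of a] by simp
      then show False using l(1) ax by (auto dest!: p_inj)
    qed
    then show "\<exists>j. j \<in> ?R \<and> j + 1 \<in> ?R \<and> p j = p i \<and> p (j + 1) = p (i + 1)" using j j1 by metis
  qed
  have count: "nat k \<le> card (sides_in ?R) + card (nonside ?R) + 2"
    using complement_edges[OF bl ax] edges unfolding k_def by linarith
  show False
  proof (cases "k < 7")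
    case False
    then have "3 \<le> card (sides_in ?R)" using count ns2 by linarith
    then show False using few by (simp add: card_tokens)
  next
    case True
    then obtain q where q: "\<And>e. e \<in> nonside ?R \<Longrightarrow> {c, p (q e)} \<in> C \<and> crs e {c, p (q e)} \<and> q e \<in> ?R \<and> apex (q e)"
      using spoked by metis
    have "inj_on (\<lambda>e. p (q e)) (nonside ?R)"
    proof (rule inj_onI)
      fix e g assume eg: "e \<in> nonside ?R" "g \<in> nonside ?R" and same: "p (q e) = p (q g)"
      have "c \<notin> p ` ?R" using p_neq_c by auto
      then have "c \<notin> e" "c \<notin> g" "e \<in> C" "g \<in> C" using eg by (auto simp: nonside_def)
      then show "e = g" using spoke_crossed_once[of "q e" e g] q[OF eg(1)] q[OF eg(2)] same by simp
    qed
    moreover have "(\<lambda>e. p (q e)) ` nonside ?R \<subseteq> apexes_in ?R" using q unfolding apexes_in_def by blast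
    moreover have "finite (apexes_in ?R)"
    proof -
      have "apexes_in ?R \<subseteq> p ` ?R" by (auto simp: apexes_in_def)
      then show ?thesis by (rule finite_subset) simp
    qed
    ultimately have "card (nonside ?R) \<le> card (apexes_in ?R)" by (rule card_inj_on_le)
    then have "nat k \<le> card (tokens ?R) + 2" using count by (simp add: card_tokens)
    moreover have "5 \<le> k" using ax m_eq h_ge by (simp add: k_def)
    ultimately show False using few by linarith
  qed
qed

lemma tokens_disjoint:
  assumes "p ` A \<inter> p ` B = {}" shows "tokens A \<inter> tokens B = {}"
proof -
  have "sides_in A \<inter> sides_in B = {}"
  proof -
    have "e \<subseteq> p ` A \<and> e \<noteq> {}" if "e \<in> sides_in A" for e A using that by (auto simp: sides_in_def)
    then show ?thesis using assms by blast
  qed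
  moreover have "apexes_in A \<inter> apexes_in B = {}" using assms by (auto simp: apexes_in_def)
  ultimately show ?thesis by (auto simp: tokens_def)
qed

text \<open>Three tokens come from a longest block and three from its complement.\<close>

lemma six_tokens: "6 \<le> card (tokens UNIV)"
proof (cases "\<exists>a x. block a x \<and> a < x \<and> x - a + 1 \<le> h")
  case False
  then show ?thesis using six_tokens_if_no_block by blast
next
  case True
  then obtain a0 x0 where "block a0 x0" "a0 < x0" "x0 - a0 + 1 \<le> h" by blast
  then obtain a x where bl: "block a x" and ax: "a < x" "x - a + 1 \<le> h"
    and longest: "\<And>a' x'. block a' x' \<Longrightarrow> a' < x' \<Longrightarrow> x' - a' + 1 \<le> h \<Longrightarrow> x' - a' \<le> x - a"
    using longest_block by metis
  let ?A = "{a..x}" and ?R = "{x + 1..a - 1 + m}"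
  have "p ` ?A \<inter> p ` ?R = {}" by (auto dest!: p_inj)
  then have "card (tokens ?A \<union> tokens ?R) = card (tokens ?A) + card (tokens ?R)"
    by (intro card_Un_disjoint finite_tokens tokens_disjoint)
  moreover have "card (tokens ?A \<union> tokens ?R) \<le> card (tokens UNIV)"
    by (intro card_mono finite_tokens Un_least tokens_mono) auto
  ultimately show ?thesis
    using block_tokens[OF bl ax] complement_tokens[OF bl ax longest] by linarith
qed

end

section \<open>The upper bound for packings\<close>

context wheel_points begin

text \<open>The geometric crossing relation satisfies the requirements of the combinatorial description.\<close>

lemma one_phc_wheel_cycle:
  assumes "one_phc points C"
  shows "one_plane_wheel_cycle p c m h C crosses"
proof -
  have ham: "hamiltonian_cycle points (complete_graph points) C" and pl: "one_plane C"
    using assms by (auto simp: one_phc_def)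
  show ?thesis
  proof
    show "C \<subseteq> nsets (insert c (range p)) 2"
      using ham by (auto simp: hamiltonian_cycle_def points_def)
    show "finite C" by (rule hamiltonian_cycle_finite[OF ham])
    show "card {e \<in> C. v \<in> e} = 2" if "v \<in> insert c (range p)" for v
      using hamiltonian_cycle_degree[OF ham] that by (simp add: points_def)
    show "cut C X \<noteq> {}" if "X \<subseteq> insert c (range p)" "X \<noteq> {}" "X \<noteq> insert c (range p)" for X
      using hamiltonian_cycle_cut[OF ham] that by (simp add: points_def)
    show "f = g" if "e \<in> C" "f \<in> C" "g \<in> C" "f \<noteq> e" "g \<noteq> e" "crosses e f" "crosses e g" for e f g
      using pl that unfolding one_plane_def Uniq_def by blast
  qed (fact m_eq h_ge p_eq_iff p_neq_centre crosses_sym chords_cross spoke_crosses_chord)+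
qed

abbreviation cycle_tokens :: "complex set set \<Rightarrow> (complex set + complex) set" where
  "cycle_tokens C \<equiv> one_plane_wheel_cycle.tokens p C UNIV"

text \<open>A common apex would mean that both cycles contain two of the same three edges.\<close>

lemma cycle_tokens_disjoint:
  assumes C: "one_phc points C" and D: "one_phc points D" and disj: "C \<inter> D = {}"
  shows "cycle_tokens C \<inter> cycle_tokens D = {}"
proof -
  interpret C: one_plane_wheel_cycle p c m h C crosses by (rule one_phc_wheel_cycle[OF C])
  interpret D: one_plane_wheel_cycle p c m h D crosses by (rule one_phc_wheel_cycle[OF D])
  have "C.sides_in UNIV \<inter> D.sides_in UNIV = {}"
    using disj by (auto simp: C.sides_in_def D.sides_in_def C.side_def D.side_def)
  moreover have "C.apexes_in UNIV \<inter> D.apexes_in UNIV = {}"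
  proof -
    have False if a: "C.apex i" "D.apex j" "p i = p j" for i j
    proof -
      have d: "m dvd i - j" using a(3) by (simp add: p_eq_iff)
      then have "p (i + 1) = p (j + 1)" "p (i - 1) = p (j - 1)" by (simp_all add: p_eq_iff)
      then show False
        using a disj unfolding C.apex_def D.apex_def C.side_def D.side_def by auto
    qed
    then show ?thesis by (auto simp: C.apexes_in_def D.apexes_in_def)
  qed
  ultimately show ?thesis by (auto simp: C.tokens_def D.tokens_def)
qed

lemma cycle_tokens_subset:
  assumes "one_phc points C"
  shows "cycle_tokens C \<subseteq> Inl ` (\<lambda>i. {p i, p (i + 1)}) ` {0..<m} \<union> Inr ` p ` {0..<m}"
proof -
  interpret C: one_plane_wheel_cycle p c m h C crosses by (rule one_phc_wheel_cycle[OF assms])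
  have "{p i, p (i + 1)} \<in> (\<lambda>i. {p i, p (i + 1)}) ` {0..<m}" for i
  proof -
    have "m dvd i - i mod m" by simp
    then have "p i = p (i mod m)" "p (i + 1) = p (i mod m + 1)" by (simp_all add: p_eq_iff)
    then show ?thesis using m_pos by (intro image_eqI[of _ _ "i mod m"]) simp_all
  qed
  then have "C.sides_in UNIV \<subseteq> (\<lambda>i. {p i, p (i + 1)}) ` {0..<m}" by (auto simp: C.sides_in_def)
  moreover have "C.apexes_in UNIV \<subseteq> p ` {0..<m}" using range_p by (auto simp: C.apexes_in_def)
  ultimately show ?thesis unfolding C.tokens_def by (intro Un_mono image_mono)
qed

lemma packing_bound:
  assumes "one_phc_packing points F"
  shows "finite F \<and> 3 * int (card F) \<le> m"
proof
  have phc: "one_phc points C" if "C \<in> F" for C using assms that by (simp add: one_phc_packing_def)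
  have "F \<subseteq> Pow (nsets points 2)"
    using phc by (auto simp: one_phc_def hamiltonian_cycle_def)
  moreover have "finite (Pow (nsets points 2))"
    using card_points(1) by (simp add: finite_imp_finite_nsets)
  ultimately show fin: "finite F" by (rule finite_subset)
  let ?U = "Inl ` (\<lambda>i. {p i, p (i + 1)}) ` {0..<m} \<union> Inr ` p ` {0..<m} :: (complex set + complex) set"
  have sub: "cycle_tokens C \<subseteq> ?U" if "C \<in> F" for C using cycle_tokens_subset[OF phc[OF that]] .
  have fU: "finite ?U" by simp
  have "6 * card F = (\<Sum>C\<in>F. 6)" by simp
  also have "\<dots> \<le> (\<Sum>C\<in>F. card (cycle_tokens C))"
    by (intro sum_mono one_plane_wheel_cycle.six_tokens[OF one_phc_wheel_cycle] phc)
  also have "\<dots> = card (\<Union>C\<in>F. cycle_tokens C)"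
  proof (rule card_UN_disjoint[symmetric])
    show "\<forall>C\<in>F. finite (cycle_tokens C)" using sub fU finite_subset by blast
    show "\<forall>C\<in>F. \<forall>D\<in>F. C \<noteq> D \<longrightarrow> cycle_tokens C \<inter> cycle_tokens D = {}"
    proof (intro ballI impI)
      fix C D assume CD: "C \<in> F" "D \<in> F" "C \<noteq> D"
      then have "C \<inter> D = {}" using assms by (simp add: one_phc_packing_def disjoint_def)
      then show "cycle_tokens C \<inter> cycle_tokens D = {}" using CD phc by (intro cycle_tokens_disjoint)
    qed
  qed (fact fin)
  also have "\<dots> \<le> card ?U" by (intro card_mono[OF fU] UN_least sub)
  also have "\<dots> \<le> nat m + nat m"
  proof -
    have "card (Inl ` (\<lambda>i. {p i, p (i + 1)}) ` {0..<m} :: (complex set + complex) set) \<le> card {0..<m}"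
      by (simp only: image_image) (rule card_image_le, simp)
    moreover have "card (Inr ` p ` {0..<m} :: (complex set + complex) set) \<le> card {0..<m}"
      by (simp only: image_image) (rule card_image_le, simp)
    ultimately show ?thesis
      using card_Un_le[of "Inl ` (\<lambda>i. {p i, p (i + 1)}) ` {0..<m} :: (complex set + complex) set" "Inr ` p ` {0..<m}"]
      by simp
  qed
  finally show "3 * int (card F) \<le> m" using m_pos by linarith
qed

section \<open>Zigzag cycles through the centre\<close>

text \<open>Chords with the same \<open>q\<close> are parallel; \<open>p q\<close> is the corner on their axis of symmetry.\<close>

definition chord :: "int \<Rightarrow> int \<Rightarrow> complex set" where "chord q y = {p (q - y), p (q + y)}"

text \<open>The sum of the indices modulo \<open>m\<close> identifies the parallel class of a chord.\<close>

lemma chord_sum: "{p i, p j} = {p k, p l} \<Longrightarrow> m dvd (i + j) - (k + l)"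
proof -
  assume "{p i, p j} = {p k, p l}"
  then have "(m dvd i - k \<and> m dvd j - l) \<or> (m dvd i - l \<and> m dvd j - k)"
    by (auto simp: doubleton_eq_iff p_eq_iff)
  then have "m dvd (i - k) + (j - l) \<or> m dvd (i - l) + (j - k)" using dvd_add by blast
  then show ?thesis by (simp add: algebra_simps)
qed

lemma chord_inj:
  assumes "chord q y = chord q z" "1 \<le> y" "y \<le> h" "1 \<le> z" "z \<le> h" shows "y = z"
proof -
  have "p (q - y) = p (q - z) \<or> p (q - y) = p (q + z)"
    using assms(1) by (auto simp: chord_def doubleton_eq_iff)
  then show ?thesis using p_inj[of "q - y" "q - z"] p_inj[of "q - y" "q + z"] assms m_eq by linarith
qed

lemma chord_neq_next: "chord q y \<noteq> chord (q + 1) z"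
proof
  assume "chord q y = chord (q + 1) z"
  then have "m dvd -2" using chord_sum[of "q - y" "q + y" "q + 1 - z" "q + 1 + z"] by (simp add: chord_def)
  then show False using m_eq h_ge dvd_imp_le_int[of "-2" m] by auto
qed

lemma parallel_chords_do_not_cross:
  assumes "1 \<le> y" "y \<le> h" "1 \<le> z" "z \<le> h" "chord q z \<noteq> chord q y"
  shows "\<not> crosses (chord q y) (chord q z)"
proof
  assume cr: "crosses (chord q y) (chord q z)"
  have "y \<noteq> z" using assms(5) by auto
  then consider "z < y" | "y < z" by linarith
  then show False
  proof cases
    case 1
    then show False
      using chords_cross_imp[of "q - y" "q + y" "q - z" "q + z"] cr assms m_eq unfolding chord_def by auto
  next
    case 2
    have eq: "chord q z = {p (q - z + m), p (q + z)}" by (simp only: chord_def p_shift)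
    show False
      using chords_cross_imp[of "q - y" "q + y" "q - z + m" "q + z"] cr assms m_eq 2
      unfolding eq unfolding chord_def by auto
  qed
qed

text \<open>The chords of two neighbouring parallel classes form a ladder along the axis: the \<open>y\<close>-th chords of both
  classes are the diagonals of one quadrilateral, and different quadrilaterals do not overlap.\<close>

lemma consecutive_chords_cross_imp:
  assumes "1 \<le> y" "y \<le> h" "1 \<le> u" "u \<le> h" and cr: "crosses (chord q y) (chord (q + 1) u)"
  shows "u = y"
proof (cases "u + y = 2 * h")
  case True then show ?thesis using assms by simp
next
  case False
  have ne: "chord (q + 1) u \<noteq> chord q y" using chord_neq_next by metis
  show ?thesis
  proof (cases "u \<le> y + 1")
    case True
    then show ?thesis
      using chords_cross_imp[of "q - y" "q + y" "q + 1 - u" "q + 1 + u"] cr ne assms m_eq False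
      unfolding chord_def by auto
  next
    case False2: False
    have eq: "chord (q + 1) u = {p (q + 1 - u + m), p (q + 1 + u)}" by (simp only: chord_def p_shift)
    show ?thesis
      using chords_cross_imp[of "q - y" "q + y" "q + 1 - u + m" "q + 1 + u"] cr ne assms m_eq False False2
      unfolding eq unfolding chord_def by auto
  qed
qed

lemma side_uncrossed:
  assumes "crosses {p q, p (q + 1)} {p k, p l}" "{p k, p l} \<noteq> {p q, p (q + 1)}" "p k \<noteq> p l"
  shows False
proof -
  obtain k' where k': "p k' = p k" "q \<le> k'" "k' < q + m" by (rule lift_index)
  obtain l' where l': "p l' = p l" "q \<le> l'" "l' < q + m" by (rule lift_index)
  have "k' \<noteq> l'" using assms(3) k' l' by auto
  then show False using chords_cross_imp[of q "q + 1" k' l'] assms k' l' m_eq h_ge by auto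
qed

lemma side_uncrossed_by_spoke: "\<not> crosses {p q, p (q + 1)} {c, p k}"
proof
  assume cr: "crosses {p q, p (q + 1)} {c, p k}"
  obtain k' where k': "p k' = p k" "q \<le> k'" "k' < q + m" by (rule lift_index)
  show False using spoke_crosses_imp[of q "q + 1" k'] cr k' h_ge by auto
qed

text \<open>The chord \<open>{q - quarter, q + quarter}\<close> spans \<open>h\<close> steps on its short side: \<open>2 * quarter\<close> is \<open>h\<close> or \<open>h + 1\<close>, that is,
  one of the two integers next to \<open>m / 2\<close>. No chord of its parallel class is closer to the centre.\<close>

definition quarter :: int where "quarter = (h + 1) div 2"

lemma quarter_cases: "2 * quarter = h \<or> 2 * quarter = h + 1" unfolding quarter_def by presburger

lemma quarter_bounds: "2 \<le> quarter" "quarter < h" using quarter_cases h_ge by auto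

text \<open>The short side of the chord is the arc around \<open>p q\<close> if \<open>2 * y \<le> h\<close>, and the opposite arc otherwise.\<close>

lemma spoke_crosses_chord_imp:
  assumes "1 \<le> y" "y \<le> h" "crosses (chord q y) {c, p (q + w)}" "- h \<le> w" "w \<le> h"
  shows "if 2 * y \<le> h then \<bar>w\<bar> < y else y < \<bar>w\<bar>"
proof (cases "2 * y \<le> h")
  case True
  have "- y < w \<and> w < y"
  proof (cases "- y \<le> w")
    case w: True
    have "crosses {p (q - y), p (q + y)} {c, p (q + w)}" using assms(3) by (simp add: chord_def)
    then have "q - y < q + w \<and> q + w < q + y"
      by (rule spoke_crosses_imp) (use assms w True m_eq in linarith)+
    then show ?thesis by simp
  next
    case w: False
    have "crosses {p (q - y), p (q + y)} {c, p (q + w + m)}" using assms(3) by (simp add: chord_def p_shift)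
    then have "q - y < q + w + m \<and> q + w + m < q + y"
      by (rule spoke_crosses_imp) (use assms w True m_eq in linarith)+
    then show ?thesis using assms m_eq by linarith
  qed
  then show ?thesis using True by auto
next
  case False
  have eq: "chord q y = {p (q + y), p (q - y + m)}" by (simp only: chord_def p_shift insert_commute)
  have "y < w \<or> w < - y"
  proof (cases "y \<le> w")
    case w: True
    have "crosses {p (q + y), p (q - y + m)} {c, p (q + w)}" using assms(3) unfolding eq .
    then have "q + y < q + w \<and> q + w < q - y + m"
      by (rule spoke_crosses_imp) (use assms w False m_eq in linarith)+
    then show ?thesis by simp
  next
    case w: False
    have "crosses {p (q + y), p (q - y + m)} {c, p (q + w + m)}" using assms(3) unfolding eq by (simp add: p_shift)
    then have "q + y < q + w + m \<and> q + w + m < q - y + m"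
      by (rule spoke_crosses_imp) (use assms w False m_eq in linarith)+
    then show ?thesis by simp
  qed
  then show ?thesis using False by auto
qed

text \<open>The edges of the zigzag cycle with axis parameter \<open>q\<close> after a chord nearest to the centre has been
  replaced by two spokes. Since being 1-plane passes to subsets, it is enough that this set contains
  the edges of the tour constructed below.\<close>

definition base_cycle :: "int \<Rightarrow> complex set set" where
  "base_cycle q = {chord q y |y. 1 \<le> y \<and> y \<le> h \<and> y \<noteq> quarter} \<union> {chord (q + 1) u |u. 1 \<le> u \<and> u \<le> h}
     \<union> {{p q, p (q + 1)}, {c, p (q + quarter)}, {c, p (q - quarter)}}"

lemma base_cycle_cases:
  assumes "e \<in> base_cycle q"
  obtains (even) y where "e = chord q y" "1 \<le> y" "y \<le> h" "y \<noteq> quarter"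
    | (odd) u where "e = chord (q + 1) u" "1 \<le> u" "u \<le> h"
    | (side) "e = {p q, p (q + 1)}"
    | (spoke) w where "e = {c, p (q + w)}" "w = quarter \<or> w = - quarter"
proof -
  from assms consider (1) "\<exists>y. e = chord q y \<and> 1 \<le> y \<and> y \<le> h \<and> y \<noteq> quarter"
    | (2) "\<exists>u. e = chord (q + 1) u \<and> 1 \<le> u \<and> u \<le> h" | (3) "e = {p q, p (q + 1)}"
    | (4) "e = {c, p (q + quarter)}" | (5) "e = {c, p (q + - quarter)}"
    unfolding base_cycle_def by auto
  then show ?thesis
  proof cases
    case 4 then show ?thesis by (rule spoke) simp
  next
    case 5 then show ?thesis by (rule spoke) simp
  qed (use even odd side in blast)+
qed

text \<open>Exactly one of the two spokes meets a chord, namely the former partner of the removed chord. Which one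
  it is depends on the side of the removed chord on which the centre lies.\<close>

definition crossed_spoke :: int where "crossed_spoke = (if 2 * quarter = h then quarter else - quarter)"

lemma spoke_even: "1 \<le> y \<Longrightarrow> y \<le> h \<Longrightarrow> w = quarter \<or> w = - quarter \<Longrightarrow> \<not> crosses (chord q y) {c, p (q + w)}"
  using spoke_crosses_chord_imp[of y q w] quarter_cases quarter_bounds by (auto split: if_splits)

lemma spoke_odd:
  assumes "1 \<le> u" "u \<le> h" "w = quarter \<or> w = - quarter" "crosses (chord (q + 1) u) {c, p (q + w)}"
  shows "u = quarter \<and> w = crossed_spoke"
proof -
  have "if 2 * u \<le> h then \<bar>w - 1\<bar> < u else u < \<bar>w - 1\<bar>"
    by (rule spoke_crosses_chord_imp[of u "q + 1" "w - 1"]) (use assms quarter_bounds h_ge in auto)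
  then show ?thesis using assms(3) quarter_cases quarter_bounds unfolding crossed_spoke_def
    by (auto split: if_splits)
qed

lemma spokes_uncrossed:
  assumes "v = quarter \<or> v = - quarter" "w = quarter \<or> w = - quarter" "{c, p (q + v)} \<noteq> {c, p (q + w)}"
  shows "\<not> crosses {c, p (q + v)} {c, p (q + w)}"
proof -
  have "\<not> crosses {c, p (q - quarter)} {c, p (q + quarter)}"
  proof (cases "2 * quarter = h")
    case True
    then show ?thesis using spokes_do_not_cross[of "q - quarter" "q + quarter"] quarter_bounds by simp
  next
    case False
    then have "\<not> crosses {c, p (q + quarter)} {c, p (q - quarter + m)}"
      using quarter_cases m_eq h_ge by (intro spokes_do_not_cross) auto
    then show ?thesis using crosses_sym p_shift(1) by metis
  qed
  then show ?thesis using assms crosses_sym by auto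
qed

lemma base_cycle_crossing:
  assumes e: "e \<in> base_cycle q" and f: "f \<in> base_cycle q" and ne: "f \<noteq> e" and cr: "crosses e f"
  shows "(\<exists>y. 1 \<le> y \<and> y \<le> h \<and> y \<noteq> quarter \<and> {e, f} = {chord q y, chord (q + 1) y})
       \<or> {e, f} = {chord (q + 1) quarter, {c, p (q + crossed_spoke)}}"
proof -
  have cr': "crosses f e" using cr by (rule crosses_sym)
  have no_side: False if "g \<in> base_cycle q" "g \<noteq> {p q, p (q + 1)}" "crosses {p q, p (q + 1)} g" for g
    using that(1)
  proof (cases rule: base_cycle_cases)
    case (even y)
    have "p (q - y) \<noteq> p (q + y)" using p_inj[of "q - y" "q + y"] even m_eq by auto
    then show False using side_uncrossed that even unfolding chord_def by metis
  next
    case (odd u)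
    have "p (q + 1 - u) \<noteq> p (q + 1 + u)" using p_inj[of "q + 1 - u" "q + 1 + u"] odd m_eq by auto
    then show False using side_uncrossed that odd unfolding chord_def by metis
  next
    case side
    then show False using that by simp
  next
    case (spoke w)
    then show False using that side_uncrossed_by_spoke by simp
  qed
  from e show ?thesis
  proof (cases rule: base_cycle_cases)
    case E: (even y)
    from f show ?thesis
    proof (cases rule: base_cycle_cases)
      case (even z)
      then show ?thesis using E ne cr parallel_chords_do_not_cross[of y z q] by simp
    next
      case (odd u)
      then have "u = y" using E cr consecutive_chords_cross_imp[of y u q] by simp
      then show ?thesis using E odd by blast
    next
      case side
      then show ?thesis using no_side[OF e] ne cr' by simp
    next
      case (spoke w)
      then show ?thesis using E cr spoke_even[of y w q] by simp
    qed
  next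
    case E: (odd y)
    from f show ?thesis
    proof (cases rule: base_cycle_cases)
      case (even z)
      then have "y = z" using E cr' consecutive_chords_cross_imp[of z y q] by simp
      then show ?thesis using E even by blast
    next
      case (odd u)
      then show ?thesis using E ne cr parallel_chords_do_not_cross[of y u "q + 1"] by simp
    next
      case side
      then show ?thesis using no_side[OF e] ne cr' by simp
    next
      case (spoke w)
      then show ?thesis using E cr spoke_odd[of y w q] by simp
    qed
  next
    case side
    then show ?thesis using no_side[OF f] ne cr by simp
  next
    case E: (spoke v)
    from f show ?thesis
    proof (cases rule: base_cycle_cases)
      case (even z)
      then show ?thesis using E cr' spoke_even[of z v q] by simp
    next
      case (odd u)
      then show ?thesis using E cr' spoke_odd[of u v q] by (simp add: insert_commute)
    next
      case side
      then show ?thesis using no_side[OF e] ne cr' by simp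
    next
      case (spoke w)
      then show ?thesis using E cr ne spokes_uncrossed[of v w q] by simp
    qed
  qed
qed

lemma one_plane_base_cycle: "one_plane (base_cycle q)"
  unfolding one_plane_def Uniq_def
proof (intro ballI allI impI)
  fix e f g
  assume e: "e \<in> base_cycle q" and f: "f \<in> base_cycle q \<and> f \<noteq> e \<and> crosses e f"
    and g: "g \<in> base_cycle q \<and> g \<noteq> e \<and> crosses e g"
  have c_chord: "c \<notin> chord q' y" for q' y
    unfolding chord_def using p_neq_centre by (metis insertE singletonD)
  have pair: "(\<exists>y. 1 \<le> y \<and> y \<le> h \<and> y \<noteq> quarter \<and> e = chord q y \<and> k = chord (q + 1) y)
     \<or> (\<exists>y. 1 \<le> y \<and> y \<le> h \<and> y \<noteq> quarter \<and> e = chord (q + 1) y \<and> k = chord q y)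
     \<or> (e = chord (q + 1) quarter \<and> k = {c, p (q + crossed_spoke)})
     \<or> (e = {c, p (q + crossed_spoke)} \<and> k = chord (q + 1) quarter)"
    if "k \<in> base_cycle q \<and> k \<noteq> e \<and> crosses e k" for k
    using base_cycle_crossing[OF e, of k] that unfolding doubleton_eq_iff by metis
  have quarter: "1 \<le> quarter" "quarter \<le> h" using quarter_bounds by auto
  have ne: "chord q y \<noteq> chord (q + 1) z" "chord (q + 1) z \<noteq> chord q y"
    "chord q' y \<noteq> {c, x}" "{c, x} \<noteq> chord q' y" for q' y z x
    using chord_neq_next[of q y z] c_chord[of q' y] by auto
  from pair[OF f] show "f = g"
  proof (elim disjE exE conjE)
    fix y assume y: "1 \<le> y" "y \<le> h" "e = chord q y" "f = chord (q + 1) y"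
    then obtain z where "1 \<le> z" "z \<le> h" "chord q y = chord q z" "g = chord (q + 1) z"
      using pair[OF g] ne by auto
    then show "f = g" using y chord_inj[of q y z] by simp
  next
    fix y assume y: "1 \<le> y" "y \<le> h" "y \<noteq> quarter" "e = chord (q + 1) y" "f = chord q y"
    then obtain z where "1 \<le> z" "z \<le> h" "chord (q + 1) y = chord (q + 1) z" "g = chord q z"
      using pair[OF g] ne chord_inj[of "q + 1" y quarter] quarter by auto
    then show "f = g" using y chord_inj[of "q + 1" y z] by simp
  next
    assume e: "e = chord (q + 1) quarter" and "f = {c, p (q + crossed_spoke)}"
    then show "f = g" using pair[OF g] ne chord_inj[of "q + 1" quarter] quarter by auto
  next
    assume "e = {c, p (q + crossed_spoke)}" "f = chord (q + 1) quarter"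
    then show "f = g" using pair[OF g] ne by auto
  qed
qed

text \<open>Starting at \<open>0\<close>, the reflections with index sums 2 and 0 are applied in turn: \<open>0, 2, -2, 4, -4, \<dots>\<close>. Modulo \<open>m\<close> the
  terms with index below \<open>m\<close> are a permutation of the corners that ends in \<open>1\<close>.\<close>

definition zigzag :: "int \<Rightarrow> int" where "zigzag k = (if even k then - k else k + 1)"

text \<open>For indices of different parity the difference of the terms is \<open>k + l + 1\<close> up to sign, an even number
  strictly between \<open>0\<close> and \<open>2 * m\<close>. It is not \<open>m\<close>, which is odd.\<close>

lemma zigzag_inj:
  assumes "0 \<le> k" "k < m" "0 \<le> l" "l < m" "p (q + zigzag k) = p (q + zigzag l)" shows "k = l"
proof -
  have d: "m dvd zigzag k - zigzag l" using assms(5) by (simp add: p_eq_iff)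
  have mixed: "\<not> m dvd k + l + 1" if "even (k + l + 1)"
  proof
    assume "m dvd k + l + 1"
    then obtain s where s: "k + l + 1 = m * s" by auto
    then have "even s" using that m_eq by auto
    moreover have "0 < m * s" "m * s < m * 2" using s assms by linarith+
    then have "0 < s" "s < 2" using m_pos by (simp_all add: zero_less_mult_iff)
    ultimately show False by presburger
  qed
  consider "even k" "even l" | "odd k" "odd l" | "odd (k + l)" by auto
  then show ?thesis
  proof cases
    case 1
    then have "m dvd l - k" using d by (simp add: zigzag_def)
    then have "p l = p k" by (simp add: p_eq_iff)
    then show ?thesis using p_inj[of l k] assms by simp
  next
    case 2
    then have "m dvd k - l" using d by (simp add: zigzag_def)
    then have "p k = p l" by (simp add: p_eq_iff)
    then show ?thesis using p_inj[of k l] assms by simp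
  next
    case 3
    then have "zigzag k - zigzag l = k + l + 1 \<or> zigzag k - zigzag l = - (k + l + 1)"
      by (auto simp: zigzag_def)
    then have "m dvd k + l + 1" using d by (metis dvd_minus_iff)
    then show ?thesis using mixed 3 by simp
  qed
qed

text \<open>The tour leaves the centre for the \<open>start\<close>-th term of the zigzag and comes back from the preceding one,
  so that it skips the edge between them. This must be the chord with \<open>y = quarter\<close>. It joins the terms
  with indices \<open>k - 1\<close> and \<open>k\<close>, where \<open>k\<close> is the even one of \<open>quarter\<close> and \<open>m - quarter\<close>.\<close>

definition start :: int where "start = (if even quarter then quarter else m - quarter)"

lemma start: "even start" "2 \<le> start" "start < m" "start = quarter \<or> start = m - quarter"
  using quarter_bounds m_eq unfolding start_def by auto

lemma zigzag_edge:
  assumes "0 \<le> k" "k < m" "k \<noteq> start - 1"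
  shows "{p (q + zigzag k), p (q + zigzag ((k + 1) mod m))} \<in> base_cycle q"
proof (cases "k = m - 1")
  case True
  have "even k" using True m_eq by simp
  then have "p (q + zigzag k) = p (q + 1)" using True by (simp add: zigzag_def p_eq_iff)
  moreover have "zigzag ((k + 1) mod m) = 0" using True by (simp add: zigzag_def)
  ultimately show ?thesis by (simp add: base_cycle_def insert_commute)
next
  case False
  then have mod: "(k + 1) mod m = k + 1" using assms by simp
  have mirror: "chord q' (m - y) = chord q' y" for q' y
  proof -
    have "p (q' - (m - y)) = p (q' + y)" "p (q' + (m - y)) = p (q' - y)" by (simp_all add: p_eq_iff)
    then show ?thesis by (simp add: chord_def insert_commute)
  qed
  have half: "\<exists>y. 1 \<le> y \<and> y \<le> h \<and> (y = k + 1 \<or> y = m - (k + 1))"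
  proof (cases "k + 1 \<le> h")
    case True then show ?thesis using assms(1) by (intro exI[of _ "k + 1"]) simp
  next
    case small: False
    have "1 \<le> m - (k + 1)" "m - (k + 1) \<le> h" using assms False small m_eq by linarith+
    then show ?thesis by (intro exI[of _ "m - (k + 1)"]) simp
  qed
  then obtain y where y: "1 \<le> y" "y \<le> h" "y = k + 1 \<or> y = m - (k + 1)" by blast
  show ?thesis
  proof (cases "even k")
    case True
    then have "{p (q + zigzag k), p (q + zigzag (k + 1))} = chord (q + 1) (k + 1)"
      by (simp add: zigzag_def chord_def insert_commute algebra_simps)
    also have "\<dots> = chord (q + 1) y" using y(3) mirror by auto
    finally show ?thesis using y mod unfolding base_cycle_def by auto
  next
    case False
    then have "{p (q + zigzag k), p (q + zigzag (k + 1))} = chord q (k + 1)"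
      by (simp add: zigzag_def chord_def insert_commute algebra_simps)
    also have "\<dots> = chord q y" using y(3) mirror by auto
    finally have "{p (q + zigzag k), p (q + zigzag (k + 1))} = chord q y" .
    moreover have "y \<noteq> quarter"
    proof
      assume "y = quarter"
      then have "k + 1 = quarter \<or> k + 1 = m - quarter" using y(3) by auto
      moreover have "even (k + 1)" using False by simp
      ultimately have "(even quarter \<and> k + 1 = quarter) \<or> (odd quarter \<and> k + 1 = m - quarter)"
        using m_eq by (metis even_add even_diff even_mult_iff odd_one even_numeral)
      then show False using assms(3) unfolding start_def by auto
    qed
    ultimately show ?thesis using y mod unfolding base_cycle_def by auto
  qed
qed

lemma zigzag_ends:
  "{c, p (q + zigzag start)} \<in> base_cycle q" "{c, p (q + zigzag (start - 1))} \<in> base_cycle q"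
proof -
  have z: "zigzag start = - start" "zigzag (start - 1) = start" using start(1) by (simp_all add: zigzag_def)
  have "p (q - (m - quarter)) = p (q + quarter)" "p (q + (m - quarter)) = p (q - quarter)" by (simp_all add: p_eq_iff)
  then show "{c, p (q + zigzag start)} \<in> base_cycle q" "{c, p (q + zigzag (start - 1))} \<in> base_cycle q"
    using start(4) unfolding z base_cycle_def by auto
qed

definition tour :: "int \<Rightarrow> complex list" where
  "tour q = c # map (\<lambda>i. p (q + zigzag ((start + int i) mod m))) [0..<nat m]"

definition tour_edges :: "int \<Rightarrow> complex set set" where
  "tour_edges q = (\<lambda>i. {tour q ! i, tour q ! (Suc i mod length (tour q))}) ` {..<length (tour q)}"

lemma length_tour: "length (tour q) = Suc (nat m)" by (simp add: tour_def)

lemma tour_nth: "i < nat m \<Longrightarrow> tour q ! Suc i = p (q + zigzag ((start + int i) mod m))"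
  by (simp add: tour_def)

lemma tour_0: "tour q ! 0 = c" by (simp add: tour_def)

lemma distinct_tour: "distinct (tour q)"
proof -
  have "inj_on (\<lambda>i. p (q + zigzag ((start + int i) mod m))) {0..<nat m}"
  proof (rule inj_onI)
    fix i j assume ij: "i \<in> {0..<nat m}" "j \<in> {0..<nat m}"
      and eq: "p (q + zigzag ((start + int i) mod m)) = p (q + zigzag ((start + int j) mod m))"
    have "(start + int i) mod m = (start + int j) mod m"
      using zigzag_inj[OF _ _ _ _ eq] m_pos by simp
    then have "p (start + int i) = p (start + int j)" by (simp add: p_eq_iff mod_eq_dvd_iff)
    then show "i = j" using p_inj[of "start + int i" "start + int j"] ij by auto
  qed
  moreover have "c \<noteq> p i" for i using p_neq_centre by metis
  ultimately show ?thesis by (auto simp: tour_def distinct_map)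
qed

lemma set_tour: "set (tour q) = points"
proof (rule card_subset_eq)
  show "finite points" by (rule card_points)
  show "set (tour q) \<subseteq> points" by (auto simp: tour_def points_def)
  show "card (set (tour q)) = card points"
    using distinct_card[OF distinct_tour] by (simp add: card_points length_tour)
qed

lemma tour_edges_subset: "tour_edges q \<subseteq> base_cycle q"
proof -
  have "{tour q ! i, tour q ! (Suc i mod Suc (nat m))} \<in> base_cycle q" if i: "i < Suc (nat m)" for i
  proof -
    have m0: "0 < nat m" using m_pos by simp
    consider "i = 0" | j where "i = Suc j" "Suc j < nat m" | "i = nat m" using i by (cases i) (auto simp: less_Suc_eq)
    then show ?thesis
    proof cases
      case 1
      have "tour q ! Suc 0 = p (q + zigzag start)" using tour_nth[OF m0, of q] start by simp
      then show ?thesis using 1 zigzag_ends(1) m0 by (simp add: tour_0)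
    next
      case (2 j)
      define k where "k = (start + int j) mod m"
      have k: "0 \<le> k" "k < m" using m_pos by (simp_all add: k_def)
      have next_k: "(start + int (Suc j)) mod m = (k + 1) mod m"
        by (simp add: k_def mod_simps algebra_simps)
      have "k \<noteq> start - 1"
      proof
        assume "k = start - 1"
        then have "p k = p (start - 1)" by simp
        moreover have "p k = p (start + int j)" unfolding k_def by (rule p_mod)
        ultimately have "m dvd int (Suc j)" by (simp add: p_eq_iff add.commute)
        then show False using 2 zdvd_imp_le[of m "int (Suc j)"] by simp
      qed
      then have "{p (q + zigzag k), p (q + zigzag ((k + 1) mod m))} \<in> base_cycle q"
        using k by (intro zigzag_edge)
      moreover have "tour q ! i = p (q + zigzag k)" using 2 by (simp add: tour_nth k_def)
      moreover have "tour q ! (Suc i mod Suc (nat m)) = p (q + zigzag ((k + 1) mod m))"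
        using tour_nth[OF 2(2), of q] 2 unfolding next_k by simp
      ultimately show ?thesis by simp
    next
      case 3
      obtain j where j: "nat m = Suc j" using m0 by (cases "nat m") auto
      have "start + int j = (start - 1) + m" using j m_pos by linarith
      then have "(start + int j) mod m = (start - 1) mod m" by (simp only: mod_add_self2)
      also have "\<dots> = start - 1" using start by simp
      finally have "(start + int j) mod m = start - 1" .
      then have "tour q ! i = p (q + zigzag (start - 1))" using tour_nth[of j q] j 3 by simp
      then show ?thesis using 3 zigzag_ends(2)[of q] by (simp add: tour_0 insert_commute)
    qed
  qed
  then show ?thesis by (auto simp: tour_edges_def length_tour)
qed

lemma one_phc_tour: "one_phc points (tour_edges q)"
proof -
  have "{tour q ! i, tour q ! (Suc i mod length (tour q))} \<in> nsets points 2" if "i < length (tour q)" for i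
  proof -
    let ?j = "Suc i mod length (tour q)"
    have len: "3 \<le> length (tour q)" using length_tour m_eq h_ge by simp
    have j: "?j < length (tour q)" using len by (intro mod_less_divisor) linarith
    have "?j \<noteq> i" using that len by (auto simp: mod_Suc)
    then have "tour q ! i \<noteq> tour q ! ?j" using distinct_tour that j by (simp add: nth_eq_iff_index_eq)
    moreover have "tour q ! i \<in> points" "tour q ! ?j \<in> points" using set_tour that j nth_mem by blast+
    ultimately show ?thesis by simp
  qed
  then have sub: "tour_edges q \<subseteq> complete_graph points" unfolding tour_edges_def by blast
  have len: "3 \<le> length (tour q)" using length_tour m_eq h_ge by simp
  have "hamiltonian_cycle points (complete_graph points) (tour_edges q)"
    unfolding hamiltonian_cycle_def
    by (intro conjI exI[of _ "tour q"] sub distinct_tour set_tour len tour_edges_def)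
  moreover have "one_plane (tour_edges q)"
    using one_plane_base_cycle[of q] tour_edges_subset[of q] unfolding one_plane_def Uniq_def by blast
  ultimately show ?thesis by (simp add: one_phc_def)
qed

text \<open>The multiple of \<open>m\<close> is smaller than \<open>m\<close> in absolute value. So it is zero, and \<open>d\<close> is a multiple of three.\<close>

lemma multiple_of_three_step:
  assumes "m dvd 3 * (s - t) + d" "- 2 \<le> d" "d \<le> 2" "0 \<le> s" "0 \<le> t" "3 * s + 3 \<le> m" "3 * t + 3 \<le> m"
  shows "s = t"
proof -
  have "3 * (s - t) + d = 0"
    using dvd_imp_le_int[OF _ assms(1)] assms m_pos by (cases "3 * (s - t) + d = 0") auto
  then show ?thesis using assms(2,3) by presburger
qed

text \<open>As \<open>h + 1\<close> is the inverse of 2 modulo \<open>m\<close>, twice this number is congruent to \<open>3 * k\<close>.\<close>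

definition shift :: "int \<Rightarrow> int" where "shift k = 3 * k * (h + 1)"

lemma shift_double: "2 * shift t = 3 * t + m * (3 * t)"
  unfolding shift_def m_eq by (simp add: algebra_simps)

text \<open>For rim edges, compare the index sums \<open>2 * q + d\<close> with \<open>d \<in> {0, 1, 2}\<close>. A common spoke would, after doubling the
  indices, make \<open>3 * (s - t)\<close> congruent to \<open>0\<close> or \<open>\<plusminus>(4 * quarter)\<close>; but \<open>4 * quarter\<close> is \<open>m - 1\<close> or \<open>m + 1\<close>,
  so this is \<open>0\<close> or \<open>\<plusminus>1\<close>, and \<open>\<plusminus>1\<close> is not a multiple of three in the available range.\<close>

lemma base_cycles_disjoint:
  assumes "0 \<le> s" "0 \<le> t" "3 * s + 3 \<le> m" "3 * t + 3 \<le> m" "s \<noteq> t"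
  shows "base_cycle (shift s) \<inter> base_cycle (shift t) = {}"
proof -
  have kind: "(\<exists>i j d. e = {p i, p j} \<and> i + j = 2 * q + d \<and> 0 \<le> d \<and> d \<le> 2)
      \<or> (\<exists>w. e = {c, p (q + w)} \<and> (w = quarter \<or> w = - quarter))" if "e \<in> base_cycle q" for e q
    using that
  proof (cases rule: base_cycle_cases)
    case (even y)
    then show ?thesis unfolding chord_def by (intro disjI1 exI[of _ "q - y"] exI[of _ "q + y"] exI[of _ 0]) auto
  next
    case (odd u)
    then show ?thesis unfolding chord_def by (intro disjI1 exI[of _ "q + 1 - u"] exI[of _ "q + 1 + u"] exI[of _ 2]) auto
  next
    case side
    then show ?thesis by (intro disjI1 exI[of _ q] exI[of _ "q + 1"] exI[of _ 1]) auto
  next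
    case spoke
    then show ?thesis by blast
  qed
  have centre: "{p i, p j} \<noteq> {c, v}" for i j v using p_neq_centre by (auto simp: doubleton_eq_iff)
  have False if e: "e \<in> base_cycle (shift s)" "e \<in> base_cycle (shift t)" for e
  proof -
    have "(\<exists>i j. e = {p i, p j}) \<longleftrightarrow> \<not> (\<exists>v. e = {c, v})"
      using kind[OF e(1)] centre by metis
    then consider (rim) i j d i' j' d' where
        "e = {p i, p j}" "i + j = 2 * shift s + d" "0 \<le> d" "d \<le> 2"
        "e = {p i', p j'}" "i' + j' = 2 * shift t + d'" "0 \<le> d'" "d' \<le> 2"
      | (spoke) v w where "e = {c, p (shift s + v)}" "v = quarter \<or> v = - quarter"
          "e = {c, p (shift t + w)}" "w = quarter \<or> w = - quarter"
      using kind[OF e(1)] kind[OF e(2)] by metis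
    then show False
    proof cases
      case (rim i j d i' j' d')
      note 1 = rim(1-4) and 2 = rim(5-8)
      have "m dvd (i + j) - (i' + j')" using chord_sum 1(1) 2(1) by metis
      also have "(i + j) - (i' + j') = 3 * (s - t) + (d - d') + m * (3 * s - 3 * t)"
        unfolding 1(2) 2(2) shift_double by (simp add: algebra_simps)
      finally have "m dvd 3 * (s - t) + (d - d')" by (metis dvd_add_left_iff dvd_triv_left)
      then show False using multiple_of_three_step[of s t "d - d'"] assms 1 2 by auto
    next
      case (spoke v w)
      note 1 = spoke(1,2) and 2 = spoke(3,4)
      have "p (shift s + v) = p (shift t + w)" using 1(1) 2(1) by (metis doubleton_eq_iff)
      then have "m dvd (shift s + v) - (shift t + w)" by (simp only: p_eq_iff)
      then have "m dvd 2 * ((shift s + v) - (shift t + w))" by (rule dvd_mult)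
      also have "2 * ((shift s + v) - (shift t + w)) = 3 * (s - t) + 2 * (v - w) + m * (3 * s - 3 * t)"
        using shift_double[of s] shift_double[of t] by (simp add: algebra_simps)
      finally have dvd: "m dvd 3 * (s - t) + 2 * (v - w)" by (metis dvd_add_left_iff dvd_triv_left)
      obtain d k where "2 * (v - w) = d + m * k" "- 2 \<le> d" "d \<le> 2"
      proof -
        have "4 * quarter = m - 1 \<or> 4 * quarter = m + 1" using quarter_cases m_eq by auto
        then have "2 * (v - w) \<in> {0, m - 1, m + 1, 1 - m, - 1 - m}" using 1(2) 2(2) by auto
        then show ?thesis using that[of 0 0] that[of "-1" 1] that[of 1 1] that[of 1 "-1"] that[of "-1" "-1"] by auto
      qed
      then have "m dvd 3 * (s - t) + d" using dvd by (metis add.assoc dvd_add_left_iff dvd_triv_left)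
      then show False using multiple_of_three_step[of s t d] assms \<open>- 2 \<le> d\<close> \<open>d \<le> 2\<close> by auto
    qed
  qed
  then show ?thesis by blast
qed

lemma packing_exists:
  "\<exists>F. one_phc_packing points F \<and> finite F \<and> card F = nat (m div 3)"
proof -
  let ?T = "{0..<m div 3}"
  define F where "F = (\<lambda>t. tour_edges (shift t)) ` ?T"
  have disj: "tour_edges (shift s) \<inter> tour_edges (shift t) = {}" if "s \<in> ?T" "t \<in> ?T" "s \<noteq> t" for s t
  proof -
    have "3 * s + 3 \<le> m" "3 * t + 3 \<le> m" using that by auto
    then show ?thesis using base_cycles_disjoint[of s t] tour_edges_subset that by fastforce
  qed
  have ne: "tour_edges q \<noteq> {}" for q by (simp add: tour_edges_def length_tour lessThan_empty_iff)
  have "inj_on (\<lambda>t. tour_edges (shift t)) ?T"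
    using disj ne by (intro inj_onI) (metis Int_absorb)
  then have "card F = nat (m div 3)" unfolding F_def by (simp add: card_image)
  moreover have "one_phc_packing points F"
    unfolding one_phc_packing_def disjoint_def
  proof (intro conjI ballI impI)
    fix C D assume "C \<in> F" "D \<in> F" "C \<noteq> D"
    then obtain s t where "s \<in> ?T" "t \<in> ?T" "C = tour_edges (shift s)" "D = tour_edges (shift t)" "s \<noteq> t"
      unfolding F_def by blast
    then show "C \<inter> D = {}" using disj by simp
  qed (auto simp: F_def one_phc_tour)
  ultimately show ?thesis unfolding F_def by blast
qed

end

theorem theorem2:
  fixes n :: nat and P :: "complex set"
  assumes "n \<ge> 10" and "even n" and "regular_wheel n P"
  shows "(\<forall>F. one_phc_packing P F \<longrightarrow> finite F \<and> card F \<le> nat \<lfloor>(real n - 1) / 3\<rfloor>) \<and>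
         (\<exists>F. one_phc_packing P F \<and> finite F \<and> card F = nat \<lfloor>(real n - 1) / 3\<rfloor>)"
proof -
  obtain c r t where r: "r > 0"
    and P: "P = insert c ((\<lambda>k. c + of_real r * cis (t + 2 * pi * real k / real (n - 1))) ` {..<n - 1})"
    using assms(3) by (auto simp: regular_wheel_def)
  define m h where "m = int n - 1" and "h = (int n - 2) div 2"
  have "m = 2 * h + 1" "4 \<le> h" using assms(1,2) by (auto simp: m_def h_def)
  then interpret W: wheel_points c r t m h using r by unfold_locales
  have rim: "c + of_real r * cis (t + 2 * pi * real k / real (n - 1)) = W.p (int k)" for k
  proof -
    have "real (n - 1) = real_of_int m" using assms(1) by (simp add: m_def of_nat_diff)
    then show ?thesis by (simp add: W.p_def)
  qed
  have "{0..<m} = int ` {..<n - 1}"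
    using assms(1) by (simp add: m_def lessThan_atLeast0 image_int_atLeastLessThan of_nat_diff)
  then have points: "P = W.points"
    unfolding P rim W.points_def W.range_p by (simp add: image_image)
  have "(real n - 1) / 3 = real_of_int m / real_of_int 3" using assms(1) by (simp add: m_def)
  then have floor: "\<lfloor>(real n - 1) / 3\<rfloor> = m div 3" by (simp only: floor_divide_of_int_eq)
  have "finite F \<and> card F \<le> nat (m div 3)" if "one_phc_packing P F" for F
    using W.packing_bound[of F] that unfolding points by linarith
  then show ?thesis using W.packing_exists unfolding points floor by blast
qed

end
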